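(* Let $n\ge 6$. Then $H_3(\mathfrak{S}_n;\mathbb{Z})\cong(\mathbb{Z}/2\mathbb{Z})^2\oplus(\mathbb{Z}/3\mathbb{Z})\oplus(\mathbb{Z}/4\mathbb{Z})$. Moreover, in terms of the complex $P_*$ of the context, this group is generated by the classes $[\bar c^{3,1}_1]$ and $[\bar c^{3,3}_{135}]$, which have order $2$, the class $[\bar c^{3,6}_1]$, which has order $3$, and the class $[\bar c^{3,7}_1+\bar c^{3,2}_{13}]$, which has order $4$.
   Context: $\mathfrak{S}_n$ is the symmetric group on $\{1,\dots,n\}$ and $s_i=(i,i+1)$ for $1\le i\le n-1$. **The complex $P_*$.** $P_0,P_1,P_2,P_3$ are free left $\mathbb{Z}\mathfrak{S}_n$-modules with the following free bases and boundary maps $\partial$. $P_0$: one generator $*$ (augmentation $*\mapsto 1$). $P_1$: generators $e_1,\dots,e_{n-1}$, with $\partial e_i=(s_i-1)*$. $P_2$: - $c_i$ ($1\le i\le n-1$), $\partial c_i=(s_i+1)e_i$; - $b_i$ ($1\le i\le n-2$), $\partial b_i=(1-s_i+s_{i+1}s_i)e_{i+1}-(1-s_{i+1}+s_is_{i+1})e_i$; - $d_{ij}$ ($1\le i<j\le n-1$, $j\ge i+2$), $\partial d_{ij}=(s_j-1)e_i-(s_i-1)e_j$. $P_3$: - $c^{3,1}_i$ ($1\le i\le n-1$), $\partial c^{3,1}_i=(s_i-1)c_i$; - $c^{3,2}_{ij}$ ($1\le i,j\le n-1$, $|i-j|\ge 2$), $\partial c^{3,2}_{ij}=(s_j-1)c_i-(s_i+1)d_{ij}$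 if $i<j$, and $(s_j-1)c_i+(s_i+1)d_{ji}$ if $j<i$; - $c^{3,3}_{ijk}$ ($1\le i<j<k\le n-1$, $j>i+1$, $k>j+1$), $\partial c^{3,3}_{ijk}=(s_i-1)d_{jk}-(s_j-1)d_{ik}+(s_k-1)d_{ij}$; - $c^{3,4}_{ij}$ ($1\le i\le n-2$, $1\le j\le n-1$, $j<i-1$ or $j>i+2$), $\partial c^{3,4}_{ij}=(s_j-1)b_i-(1-s_i+s_{i+1}s_i)d_{i+1,j}+(1-s_{i+1}+s_is_{i+1})d_{ij}$ if $j>i+2$, and $(s_j-1)b_i+(1-s_i+s_{i+1}s_i)d_{j,i+1}-(1-s_{i+1}+s_is_{i+1})d_{ji}$ if $j<i-1$; - $c^{3,5}_i$ ($1\le i\le n-2$), $\partial c^{3,5}_i=(s_{i+1}+1)b_i-c_{i+1}+s_is_{i+1}c_i$; - $c^{3,6}_i$ ($1\le i\le n-2$), $\partial c^{3,6}_i=(s_is_{i+1}-1)b_i+(s_{i+1}-1)(s_ic_{i+1}+c_i)$; - $c^{3,7}_i$ ($1\le i\le n-3$), $\partial c^{3,7}_i=(1-s_{i+1}+s_is_{i+1}-s_{i+2}s_is_{i+1}+s_{i+2}s_{i+1}+s_{i+1}s_{i+2}s_is_{i+1})d_{i,i+2}+(s_{i+2}-1+s_is_{i+1}s_{i+2}-s_{i+1}s_{i+2})b_i+(s_i-1+s_{i+2}s_{i+1}s_i-s_{i+1}s_i)b_{i+1}$. $P_*$ is the truncation in dimensions $\le 3$ of a free resolution of $\mathbb{Z}$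 over $\mathbb{Z}\mathfrak{S}_n$. A bar denotes the image in the coinvariants $(P_* )_{\mathfrak{S}_n}=\mathbb{Z}\otimes_{\mathbb{Z}\mathfrak{S}_n}P_*$. After completing $P_*$ to a full free resolution, each $3$-cycle of $(P_* )_{\mathfrak{S}_n}$ represents a class in $H_3(\mathfrak{S}_n;\mathbb{Z})$; equivalently, $H_3(\mathfrak{S}_n;\mathbb{Z})$ is the quotient of $\ker((P_3)_{\mathfrak{S}_n}\to(P_2)_{\mathfrak{S}_n})$ by the image of $\ker(P_3\to P_2)$. *)

theory Defs
  imports "HOL-Algebra.Algebra"
begin

section \<open>Free modules over a group ring\<close>

text \<open>
  The group ring of \<open>G\<close> is the free Abelian group on \<open>carrier G\<close>, and the free left module over it
  with basis \<open>S\<close> is the free Abelian group on \<open>carrier G \<times> S\<close>, where the pair \<open>(g, b)\<close> stands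
  for \<open>g \<cdot> b\<close>.
\<close>

definition free_mod :: "'g monoid \<Rightarrow> 'b set \<Rightarrow> ('g \<times> 'b \<Rightarrow>\<^sub>0 int) monoid" where
  "free_mod G S = free_Abelian_group (carrier G \<times> S)"

definition gact :: "'g monoid \<Rightarrow> 'g \<Rightarrow> ('g \<times> 'b \<Rightarrow>\<^sub>0 int) \<Rightarrow> ('g \<times> 'b \<Rightarrow>\<^sub>0 int)" where
  "gact G g = frag_extend (\<lambda>(h, b). frag_of (g \<otimes>\<^bsub>G\<^esub> h, b))"

definition rsmult :: "'g monoid \<Rightarrow> ('g \<Rightarrow>\<^sub>0 int) \<Rightarrow> ('g \<times> 'b \<Rightarrow>\<^sub>0 int) \<Rightarrow> ('g \<times> 'b \<Rightarrow>\<^sub>0 int)" where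
  "rsmult G r x = frag_extend (\<lambda>g. gact G g x) r"

definition gen :: "'g monoid \<Rightarrow> 'b \<Rightarrow> ('g \<times> 'b \<Rightarrow>\<^sub>0 int)" where
  "gen G b = frag_of (\<one>\<^bsub>G\<^esub>, b)"

definition lin_ext :: "'g monoid \<Rightarrow> ('b \<Rightarrow> ('g \<times> 'c \<Rightarrow>\<^sub>0 int)) \<Rightarrow> ('g \<times> 'b \<Rightarrow>\<^sub>0 int) \<Rightarrow> ('g \<times> 'c \<Rightarrow>\<^sub>0 int)" where
  "lin_ext G f = frag_extend (\<lambda>(g, b). gact G g (f b))"

definition aug_ext :: "('b \<Rightarrow> int) \<Rightarrow> ('g \<times> 'b \<Rightarrow>\<^sub>0 int) \<Rightarrow> int" where
  "aug_ext \<epsilon> x = (\<Sum>p\<in>Poly_Mapping.keys x. Poly_Mapping.lookup x p * \<epsilon> (snd p))"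


section \<open>Free resolutions and group homology\<close>

text \<open>
  A based complex of free modules is given by the bases \<open>S k\<close> and by the boundaries \<open>d k b\<close> of the
  elements \<open>b\<close> of \<open>S k\<close>, for \<open>k \<ge> 1\<close>; the values of \<open>d 0\<close> play no role.
\<close>

definition free_resolution ::
  "'g monoid \<Rightarrow> (nat \<Rightarrow> 'b set) \<Rightarrow> (nat \<Rightarrow> 'b \<Rightarrow> ('g \<times> 'b \<Rightarrow>\<^sub>0 int)) \<Rightarrow> ('b \<Rightarrow> int) \<Rightarrow> bool" where
  "free_resolution G S d \<epsilon> \<longleftrightarrow>
     (\<forall>k. \<forall>b\<in>S (Suc k). d (Suc k) b \<in> carrier (free_mod G (S k))) \<and>
     aug_ext \<epsilon> ` carrier (free_mod G (S 0)) = UNIV \<and>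
     kernel (free_mod G (S 0)) integer_group (aug_ext \<epsilon>) =
       lin_ext G (d 1) ` carrier (free_mod G (S 1)) \<and>
     (\<forall>k. kernel (free_mod G (S (Suc k))) (free_mod G (S k)) (lin_ext G (d (Suc k))) =
       lin_ext G (d (Suc (Suc k))) ` carrier (free_mod G (S (Suc (Suc k)))))"

text \<open>
  The coinvariants of a module \<open>M\<close> are \<open>M\<close> modulo the subgroup generated by all \<open>g x - x\<close>, which
  is \<open>\<int> \<otimes> M\<close> over the group ring.
\<close>

definition coinv_sub :: "'g monoid \<Rightarrow> 'b set \<Rightarrow> ('g \<times> 'b \<Rightarrow>\<^sub>0 int) set" where
  "coinv_sub G S = generate (free_mod G S)
     {gact G g x - x | g x. g \<in> carrier G \<and> x \<in> carrier (free_mod G S)}"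

definition coinv :: "'g monoid \<Rightarrow> 'b set \<Rightarrow> ('g \<times> 'b \<Rightarrow>\<^sub>0 int) set monoid" where
  "coinv G S = free_mod G S Mod coinv_sub G S"

definition bar :: "'g monoid \<Rightarrow> 'b set \<Rightarrow> ('g \<times> 'b \<Rightarrow>\<^sub>0 int) \<Rightarrow> ('g \<times> 'b \<Rightarrow>\<^sub>0 int) set" where
  "bar G S x = coinv_sub G S #>\<^bsub>free_mod G S\<^esub> x"

text \<open>
  The map induced on coinvariants: all elements of a coset have the same image, so
  \<open>coinv_map G S T f (bar G S x) = bar G T (f x)\<close> for an equivariant homomorphism \<open>f\<close>.
\<close>

definition coinv_map ::
  "'g monoid \<Rightarrow> 'b set \<Rightarrow> 'c set \<Rightarrow> (('g \<times> 'b \<Rightarrow>\<^sub>0 int) \<Rightarrow> ('g \<times> 'c \<Rightarrow>\<^sub>0 int)) \<Rightarrow>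
    ('g \<times> 'b \<Rightarrow>\<^sub>0 int) set \<Rightarrow> ('g \<times> 'c \<Rightarrow>\<^sub>0 int) set" where
  "coinv_map G S T f Y = the_elem ((\<lambda>x. bar G T (f x)) ` Y)"

definition coinv_cycles ::
  "'g monoid \<Rightarrow> (nat \<Rightarrow> 'b set) \<Rightarrow> (nat \<Rightarrow> 'b \<Rightarrow> ('g \<times> 'b \<Rightarrow>\<^sub>0 int)) \<Rightarrow> nat \<Rightarrow> ('g \<times> 'b \<Rightarrow>\<^sub>0 int) set set" where
  "coinv_cycles G S d k =
     (if k = 0 then carrier (coinv G (S 0))
      else kernel (coinv G (S k)) (coinv G (S (k - 1)))
             (coinv_map G (S k) (S (k - 1)) (lin_ext G (d k))))"

definition coinv_boundaries ::
  "'g monoid \<Rightarrow> (nat \<Rightarrow> 'b set) \<Rightarrow> (nat \<Rightarrow> 'b \<Rightarrow> ('g \<times> 'b \<Rightarrow>\<^sub>0 int)) \<Rightarrow> nat \<Rightarrow> ('g \<times> 'b \<Rightarrow>\<^sub>0 int) set set" where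
  "coinv_boundaries G S d k =
     coinv_map G (S (Suc k)) (S k) (lin_ext G (d (Suc k))) ` carrier (coinv G (S (Suc k)))"

definition coinv_cycle_group ::
  "'g monoid \<Rightarrow> (nat \<Rightarrow> 'b set) \<Rightarrow> (nat \<Rightarrow> 'b \<Rightarrow> ('g \<times> 'b \<Rightarrow>\<^sub>0 int)) \<Rightarrow> nat \<Rightarrow> ('g \<times> 'b \<Rightarrow>\<^sub>0 int) set monoid" where
  "coinv_cycle_group G S d k = (coinv G (S k))\<lparr>carrier := coinv_cycles G S d k\<rparr>"

text \<open>The homology of \<open>G\<close> with integer coefficients, computed from a free resolution \<open>S, d\<close>.\<close>

definition group_homology ::
  "'g monoid \<Rightarrow> (nat \<Rightarrow> 'b set) \<Rightarrow> (nat \<Rightarrow> 'b \<Rightarrow> ('g \<times> 'b \<Rightarrow>\<^sub>0 int)) \<Rightarrow> nat \<Rightarrow> ('g \<times> 'b \<Rightarrow>\<^sub>0 int) set set monoid" where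
  "group_homology G S d k = coinv_cycle_group G S d k Mod coinv_boundaries G S d k"

definition homology_class ::
  "'g monoid \<Rightarrow> (nat \<Rightarrow> 'b set) \<Rightarrow> (nat \<Rightarrow> 'b \<Rightarrow> ('g \<times> 'b \<Rightarrow>\<^sub>0 int)) \<Rightarrow> nat \<Rightarrow> ('g \<times> 'b \<Rightarrow>\<^sub>0 int) \<Rightarrow> ('g \<times> 'b \<Rightarrow>\<^sub>0 int) set set" where
  "homology_class G S d k x =
     coinv_boundaries G S d k #>\<^bsub>coinv_cycle_group G S d k\<^esub> bar G (S k) x"

text \<open>
  The same for a resolution truncated in dimensions \<open>\<le> k\<close>: the boundaries from dimension \<open>k + 1\<close>
  are the image of the kernel of \<open>d k\<close>, by exactness of any completion.
\<close>

definition trunc_boundaries ::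
  "'g monoid \<Rightarrow> (nat \<Rightarrow> 'b set) \<Rightarrow> (nat \<Rightarrow> 'b \<Rightarrow> ('g \<times> 'b \<Rightarrow>\<^sub>0 int)) \<Rightarrow> nat \<Rightarrow> ('g \<times> 'b \<Rightarrow>\<^sub>0 int) set set" where
  "trunc_boundaries G S d k =
     bar G (S k) ` kernel (free_mod G (S k)) (free_mod G (S (k - 1))) (lin_ext G (d k))"

definition trunc_homology ::
  "'g monoid \<Rightarrow> (nat \<Rightarrow> 'b set) \<Rightarrow> (nat \<Rightarrow> 'b \<Rightarrow> ('g \<times> 'b \<Rightarrow>\<^sub>0 int)) \<Rightarrow> nat \<Rightarrow> ('g \<times> 'b \<Rightarrow>\<^sub>0 int) set set monoid" where
  "trunc_homology G S d k = coinv_cycle_group G S d k Mod trunc_boundaries G S d k"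

definition trunc_class ::
  "'g monoid \<Rightarrow> (nat \<Rightarrow> 'b set) \<Rightarrow> (nat \<Rightarrow> 'b \<Rightarrow> ('g \<times> 'b \<Rightarrow>\<^sub>0 int)) \<Rightarrow> nat \<Rightarrow> ('g \<times> 'b \<Rightarrow>\<^sub>0 int) \<Rightarrow> ('g \<times> 'b \<Rightarrow>\<^sub>0 int) set set" where
  "trunc_class G S d k x =
     trunc_boundaries G S d k #>\<^bsub>coinv_cycle_group G S d k\<^esub> bar G (S k) x"


section \<open>The partial resolution for the symmetric group\<close>

text \<open>
  Names of the free generators. \<open>Gext\<close> is not used by the complex itself: it leaves room for
  generators in dimensions \<open>\<ge> 4\<close> of a completion to a full resolution.
\<close>

datatype 'x cell =
    Gstar
  | Ge nat
  | Gc nat | Gb nat | Gd nat nat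
  | G31 nat | G32 nat nat | G33 nat nat nat | G34 nat nat | G35 nat | G36 nat | G37 nat
  | Gext 'x

type_synonym 'x schain = "(nat \<Rightarrow> nat) \<times> 'x cell \<Rightarrow>\<^sub>0 int"

definition P_basis :: "nat \<Rightarrow> nat \<Rightarrow> 'x cell set" where
  "P_basis n k =
    (if k = 0 then {Gstar}
     else if k = 1 then {Ge i | i. 1 \<le> i \<and> i \<le> n - 1}
     else if k = 2 then
       {Gc i | i. 1 \<le> i \<and> i \<le> n - 1} \<union>
       {Gb i | i. 1 \<le> i \<and> i \<le> n - 2} \<union>
       {Gd i j | i j. 1 \<le> i \<and> i < j \<and> j \<le> n - 1 \<and> j \<ge> i + 2}
     else if k = 3 then
       {G31 i | i. 1 \<le> i \<and> i \<le> n - 1} \<union>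
       {G32 i j | i j. 1 \<le> i \<and> i \<le> n - 1 \<and> 1 \<le> j \<and> j \<le> n - 1 \<and> \<bar>int i - int j\<bar> \<ge> 2} \<union>
       {G33 i j k | i j k. 1 \<le> i \<and> i < j \<and> j < k \<and> k \<le> n - 1 \<and> j > i + 1 \<and> k > j + 1} \<union>
       {G34 i j | i j. 1 \<le> i \<and> i \<le> n - 2 \<and> 1 \<le> j \<and> j \<le> n - 1 \<and> (j < i - 1 \<or> j > i + 2)} \<union>
       {G35 i | i. 1 \<le> i \<and> i \<le> n - 2} \<union>
       {G36 i | i. 1 \<le> i \<and> i \<le> n - 2} \<union>
       {G37 i | i. 1 \<le> i \<and> i \<le> n - 3}
     else {})"

text \<open>
  \<open>sw [i\<^sub>1, \<dots>, i\<^sub>r]\<close> is the product \<open>s\<^bsub>i\<^sub>1\<^esub> \<cdots> s\<^bsub>i\<^sub>r\<^esub>\<close> of the adjacent transpositions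
  \<open>s\<^sub>i = (i, i + 1)\<close>, as an element of the group ring.
\<close>

definition sw :: "nat list \<Rightarrow> ((nat \<Rightarrow> nat) \<Rightarrow>\<^sub>0 int)" where
  "sw is = frag_of (foldr (\<lambda>i p. transpose i (i + 1) \<circ> p) is id)"

fun P_bd :: "nat \<Rightarrow> 'x cell \<Rightarrow> 'x schain" where
  "P_bd n Gstar = 0"
| "P_bd n (Ge i) =
    (let G = sym_group n; scal = rsmult G in
     scal (sw [i] - sw []) (gen G Gstar))"
| "P_bd n (Gc i) =
    (let G = sym_group n; scal = rsmult G in
     scal (sw [i] + sw []) (gen G (Ge i)))"
| "P_bd n (Gb i) =
    (let G = sym_group n; scal = rsmult G in
     scal (sw [] - sw [i] + sw [i+1, i]) (gen G (Ge (i+1)))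
     - scal (sw [] - sw [i+1] + sw [i, i+1]) (gen G (Ge i)))"
| "P_bd n (Gd i j) =
    (let G = sym_group n; scal = rsmult G in
     scal (sw [j] - sw []) (gen G (Ge i)) - scal (sw [i] - sw []) (gen G (Ge j)))"
| "P_bd n (G31 i) =
    (let G = sym_group n; scal = rsmult G in
     scal (sw [i] - sw []) (gen G (Gc i)))"
| "P_bd n (G32 i j) =
    (let G = sym_group n; scal = rsmult G in
     if i < j
     then scal (sw [j] - sw []) (gen G (Gc i)) - scal (sw [i] + sw []) (gen G (Gd i j))
     else scal (sw [j] - sw []) (gen G (Gc i)) + scal (sw [i] + sw []) (gen G (Gd j i)))"
| "P_bd n (G33 i j k) =
    (let G = sym_group n; scal = rsmult G in
     scal (sw [i] - sw []) (gen G (Gd j k))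
     - scal (sw [j] - sw []) (gen G (Gd i k))
     + scal (sw [k] - sw []) (gen G (Gd i j)))"
| "P_bd n (G34 i j) =
    (let G = sym_group n; scal = rsmult G in
     if j > i + 2
     then scal (sw [j] - sw []) (gen G (Gb i))
       - scal (sw [] - sw [i] + sw [i+1, i]) (gen G (Gd (i+1) j))
       + scal (sw [] - sw [i+1] + sw [i, i+1]) (gen G (Gd i j))
     else scal (sw [j] - sw []) (gen G (Gb i))
       + scal (sw [] - sw [i] + sw [i+1, i]) (gen G (Gd j (i+1)))
       - scal (sw [] - sw [i+1] + sw [i, i+1]) (gen G (Gd j i)))"
| "P_bd n (G35 i) =
    (let G = sym_group n; scal = rsmult G in
     scal (sw [i+1] + sw []) (gen G (Gb i)) - gen G (Gc (i+1))
     + scal (sw [i, i+1]) (gen G (Gc i)))"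
| "P_bd n (G36 i) =
    (let G = sym_group n; scal = rsmult G in
     scal (sw [i, i+1] - sw []) (gen G (Gb i))
     + scal (sw [i+1] - sw []) (scal (sw [i]) (gen G (Gc (i+1))) + gen G (Gc i)))"
| "P_bd n (G37 i) =
    (let G = sym_group n; scal = rsmult G in
     scal (sw [] - sw [i+1] + sw [i, i+1] - sw [i+2, i, i+1] + sw [i+2, i+1] + sw [i+1, i+2, i, i+1])
       (gen G (Gd i (i+2)))
     + scal (sw [i+2] - sw [] + sw [i, i+1, i+2] - sw [i+1, i+2]) (gen G (Gb i))
     + scal (sw [i] - sw [] + sw [i+2, i+1, i] - sw [i+1, i]) (gen G (Gb (i+1))))"
| "P_bd n (Gext x) = 0"

definition completes_P ::
  "nat \<Rightarrow> (nat \<Rightarrow> 'x cell set) \<Rightarrow> (nat \<Rightarrow> 'x cell \<Rightarrow> 'x schain) \<Rightarrow> ('x cell \<Rightarrow> int) \<Rightarrow> bool" where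
  "completes_P n S d \<epsilon> \<longleftrightarrow>
     free_resolution (sym_group n) S d \<epsilon> \<and>
     (\<forall>k\<le>3. S k = P_basis n k) \<and>
     (\<forall>k\<in>{1..3}. \<forall>b\<in>P_basis n k. d k b = P_bd n b) \<and>
     \<epsilon> Gstar = 1"

end

theory Submission
  imports Defs
begin

text \<open>
  Upper bound: explicit elements of \<open>ker \<partial>\<^sub>3\<close>, mostly the boundaries of the 4-cells of products of
  standard resolutions of parabolic subgroups and of a De Concini--Salvetti type resolution, show
  that modulo boundaries every 3-cycle of the coinvariants is a combination of the four given classes,
  and that these are killed by 2, 2, 3 and 4. Lower bound: a homomorphism \<open>f\<close> from the coinvariants of
  \<open>P\<^sub>3\<close> to \<open>\<int>/m\<close> vanishes on the image of \<open>ker \<partial>\<^sub>3\<close> as soon as \<open>f = g \<circ> \<partial>\<^sub>3\<close> for some additive, not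
  necessarily equivariant, \<open>g\<close> on \<open>P\<^sub>2\<close>. Four such \<open>g\<close>, whose values on \<open>\<sigma> c\<close> depend only on the sign of
  \<open>\<sigma>\<close> and on the relative order of the values of \<open>\<sigma>\<close> at the positions moved by \<open>c\<close>, separate the
  combinations.
\<close>

section \<open>The group ring action in terms of the generators\<close>

text \<open>The complex stops in dimension 3, so boundaries are given only as the image of ker
  \<partial>_3. An upper bound gets by with some elements of this kernel, while a lower bound has to
  control all of them; factoring through \<partial>_3 does so. A function g that ignores \<sigma>
  would make f vanish on every cycle of the coinvariants, so the dependence on \<sigma> carries the
  information. Nothing is lost: by exactness P_2 / im \<partial>_3 embeds in the free Abelian group
  P_1, so im \<partial>_3 is a direct summand of P_2 and every admissible f has such a g. For the
  upper bound the obstacle is that the cells c^{3,2}, c^{3,4} and c^{3,7} are not cycles in the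
  coinvariants, so cells with different indices can be compared only up to a correction. It is
  chosen as a linear function of the boundary and hence vanishes on cycles. The order 4 comes from 2
  c^{3,7}_1 = c^{3,2}_31 - c^{3,2}_13 and 2 (c^{3,2}_13 + c^{3,2}_31) = 0.\<close>

definition sact :: "(nat \<Rightarrow> nat) \<Rightarrow> 'x schain \<Rightarrow> 'x schain" where
  "sact p = frag_extend (\<lambda>(h, b). frag_of (p \<circ> h, b))"

definition T :: "nat \<Rightarrow> 'x schain \<Rightarrow> 'x schain" where
  "T i = sact (transpose i (i + 1))"

definition E :: "'x cell \<Rightarrow> 'x schain" where
  "E c = frag_of (id, c)"

definition bd :: "nat \<Rightarrow> 'x schain \<Rightarrow> 'x schain" where
  "bd n = lin_ext (sym_group n) (P_bd n)"

text \<open>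
  The coinvariants of a based free module are identified with the free Abelian group on its basis;
  \<open>tot\<close> is the projection onto them.
\<close>

definition tot :: "'x schain \<Rightarrow> ('x cell \<Rightarrow>\<^sub>0 int)" where
  "tot = frag_extend (\<lambda>(g, c). frag_of c)"

text \<open>The operations of \<open>sym_group n\<close> are composition and \<open>id\<close> for
  every n, so one action \<open>sact\<close> serves all n.\<close>

lemma gact_sym_group: "gact (sym_group n) = sact"
  by (rule ext) (simp add: gact_def sact_def sym_group_def)

lemma gen_sym_group: "gen (sym_group n) = E"
  by (rule ext) (simp add: gen_def E_def sym_group_def)

lemma sact_0 [simp]: "sact p 0 = 0"
  and sact_add: "sact p (x + y) = sact p x + sact p y"
  and sact_diff: "sact p (x - y) = sact p x - sact p y"
  and sact_minus: "sact p (- x) = - sact p x"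
  by (simp_all add: sact_def frag_extend_add frag_extend_diff frag_extend_minus)

lemma sact_sact: "sact p (sact q x) = sact (p \<circ> q) x"
proof (induction x rule: frag_induction[OF subset_UNIV])
  case (2 x)
  then show ?case by (auto simp: sact_def o_assoc split: prod.splits simp del: o_apply)
qed (simp_all only: sact_diff sact_0)

lemma sact_id [simp]: "sact id x = x"
proof (induction x rule: frag_induction[OF subset_UNIV])
  case (2 x)
  then show ?case by (auto simp: sact_def o_def split: prod.splits)
qed (simp_all only: sact_diff sact_0)

lemma sact_T: "sact p (T i x) = sact (p \<circ> transpose i (i + 1)) x"
  by (simp add: T_def sact_sact)

lemma rsmult_add: "rsmult G (r + s) x = rsmult G r x + rsmult G s x"
  and rsmult_diff: "rsmult G (r - s) x = rsmult G r x - rsmult G s x"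
  by (simp_all add: rsmult_def frag_extend_add frag_extend_diff)

lemma rsmult_sw: "rsmult (sym_group n) (sw is) x = foldr T is x"
proof -
  have "sact (foldr (\<lambda>i p. transpose i (i + 1) \<circ> p) is id) x = foldr T is x"
  proof (induction "is")
    case Nil
    show ?case using sact_id[of x] by (simp add: id_def)
  next
    case (Cons i "is")
    then show ?case
      using sact_sact[of "transpose i (i + 1)" "foldr (\<lambda>i p. transpose i (i + 1) \<circ> p) is id" x]
      by (simp add: T_def o_def id_def)
  qed
  then show ?thesis
    by (simp add: rsmult_def sw_def gact_sym_group)
qed

lemma T_add: "T i (x + y) = T i x + T i y"
  and T_diff: "T i (x - y) = T i x - T i y"
  and T_minus: "T i (- x) = - T i x"
  by (simp_all add: T_def sact_add sact_diff sact_minus)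

lemma T_T [simp]: "T i (T i x) = x"
  by (simp add: T_def sact_sact)

lemma T_comm: "i + 2 \<le> j \<Longrightarrow> T j (T i x) = T i (T j x)"
  unfolding T_def sact_sact by (rule arg_cong[where f = "\<lambda>p. sact p x"]) (auto simp: transpose_def fun_eq_iff)

lemma T_braid: "T (Suc i) (T i (T (Suc i) x)) = T i (T (Suc i) (T i x))"
  unfolding T_def sact_sact by (rule arg_cong[where f = "\<lambda>p. sact p x"]) (auto simp: transpose_def fun_eq_iff)

text \<open>Overlap of \<open>T_braid\<close> with \<open>T_comm\<close>: moving \<open>T i\<close>
  outwards past \<open>T (i+2)\<close> hides the left side of a braid move. This rule and
  \<open>T_braid4\<close> close such overlaps, so that rewriting still matches the words in the
  cycles of types A_3 and A_4.\<close>

lemma T_braid3: "T (Suc (Suc i)) (T (Suc i) (T i (T (Suc (Suc i)) x)))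
    = T (Suc i) (T (Suc (Suc i)) (T (Suc i) (T i x)))"
  using T_braid[of "Suc i" "T i x"] by (simp add: T_comm)

lemma T_braid4: "T (Suc (Suc (Suc i))) (T (Suc (Suc i)) (T (Suc i) (T i (T (Suc (Suc (Suc i))) x))))
    = T (Suc (Suc i)) (T (Suc (Suc (Suc i))) (T (Suc (Suc i)) (T (Suc i) (T i x))))"
  using T_braid3[of "Suc i" "T i x"] by (simp add: T_comm)

lemma bd_0 [simp]: "bd n 0 = 0"
  and bd_add: "bd n (x + y) = bd n x + bd n y"
  and bd_diff: "bd n (x - y) = bd n x - bd n y"
  and bd_minus: "bd n (- x) = - bd n x"
  by (simp_all add: bd_def lin_ext_def frag_extend_add frag_extend_diff frag_extend_minus)

lemma bd_sact: "bd n (sact p x) = sact p (bd n x)"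
proof (induction x rule: frag_induction[OF subset_UNIV])
  case (2 x)
  then show ?case
    by (auto simp: bd_def lin_ext_def gact_sym_group sact_def[of p] sact_sact split: prod.splits)
       (simp add: sact_def[symmetric] sact_sact)
qed (simp_all add: sact_diff bd_diff)

lemma bd_T: "bd n (T i x) = T i (bd n x)"
  by (simp add: T_def bd_sact)

lemma bd_E: "bd n (E c) = P_bd n c"
  by (simp add: bd_def lin_ext_def E_def gact_sym_group)

lemma tot_0 [simp]: "tot 0 = 0"
  and tot_add: "tot (x + y) = tot x + tot y"
  and tot_diff: "tot (x - y) = tot x - tot y"
  and tot_minus: "tot (- x) = - tot x"
  by (simp_all add: tot_def frag_extend_add frag_extend_diff frag_extend_minus)

lemma tot_sact: "tot (sact p x) = tot x"
proof (induction x rule: frag_induction[OF subset_UNIV])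
  case (2 x)
  then show ?case by (auto simp: sact_def tot_def split: prod.splits)
qed (simp_all add: sact_diff tot_diff)

lemma tot_T: "tot (T i x) = tot x"
  by (simp add: T_def tot_sact)

lemma tot_E: "tot (E c) = frag_of c"
  by (simp add: tot_def E_def)

lemmas P_bd_unfold = Let_def rsmult_add rsmult_diff rsmult_sw gen_sym_group

lemmas T_lin = T_add T_diff T_minus
lemmas bd_lin = bd_add bd_diff bd_minus bd_T bd_E T_add T_diff T_minus
lemmas tot_lin = tot_add tot_diff tot_minus tot_T tot_E

section \<open>Cycles of the free complex\<close>

lemma bd_cycle_31: "bd n (T i (E (G31 i)) + E (G31 i)) = 0"
  by (simp add: bd_lin P_bd_unfold)

lemma bd_cycle_35:
  "bd n (T (i+1) (E (G35 i)) - E (G35 i) + E (G31 (i+1)) - T i (T (i+1) (E (G31 i)))) = 0"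
  by (simp add: bd_lin P_bd_unfold T_braid)

text \<open>\<open>N\<close> is the norm of the cyclic group generated by s_i s_{i+1}, so it kills
  the b_i term. As N s_i = N s_{i+1} and N s_{i+1} s_i = N, the c terms become N (s_i - 1) c_i and N
  (1 - s_{i+1}) c_{i+1}, which the c^{3,1} terms cancel.\<close>

lemma bd_cycle_36:
  fixes i n
  defines "N \<equiv> \<lambda>x :: 'x schain. x + T i (T (i+1) x) + T (i+1) (T i x)"
  shows "bd n (N (E (G36 i)) - N (E (G31 i)) + N (E (G31 (i+1)))) = 0"
  by (simp add: N_def bd_lin P_bd_unfold T_braid algebra_simps)

text \<open>Up to sign c^{3,2}_ij is the product of c_i and e_j, c^{3,3}_ijk that of e_i, e_j, e_k,
  and c^{3,4}_ij that of b_i and e_j. The identities from here to \<open>bd_cycle_33_last\<close>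
  are the boundaries of the 4-dimensional products c e e, c c, c^{3,5} e, b c, b b and b e
  e.\<close>

lemma bd_cycle_33:
  assumes "i + 2 \<le> j" "j + 2 \<le> k"
  shows "bd n (T i (E (G33 i j k)) + E (G33 i j k) - (T j (E (G32 i k)) - E (G32 i k)) + (T k (E (G32 i j)) - E (G32 i j))) = 0"
  using assms by (simp add: bd_lin P_bd_unfold T_comm algebra_simps)

lemma bd_cycle_32_swap:
  assumes "i + 2 \<le> j"
  shows "bd n (T j (E (G32 i j)) + E (G32 i j) + (T i (E (G32 j i)) + E (G32 j i))) = 0"
  using assms by (simp add: bd_lin P_bd_unfold T_comm algebra_simps)

text \<open>
  The alternating sum of the minimal coset representatives of a maximal parabolic subgroup of
  type \<open>A\<^bsub>m-1\<^esub>\<close> in type \<open>A\<^sub>m\<close>; these are the coefficients of \<open>\<partial> b\<^sub>i\<close>.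
\<close>

fun asum :: "nat list \<Rightarrow> 'x schain \<Rightarrow> 'x schain" where
  "asum [] x = x"
| "asum (i # is) x = x - asum is (T i x)"

lemma bd_cycle_35_34:
  assumes "j > i + 2 \<or> j + 1 < i"
  shows "bd n (T j (E (G35 i)) - E (G35 i) - (T (i+1) (E (G34 i j)) + E (G34 i j))
      + E (G32 (i+1) j) - T i (T (i+1) (E (G32 i j)))) = 0"
proof (cases "j > i + 2")
  case True
  then have comm: "T j (T i x) = T i (T j x)" "T j (T (Suc i) x) = T (Suc i) (T j x)" for x :: "'x schain"
    by (auto intro!: T_comm)
  from True show ?thesis by (simp add: comm bd_lin P_bd_unfold T_braid algebra_simps)
next
  case False
  then have comm: "T i (T j x) = T j (T i x)" "T (Suc i) (T j x) = T j (T (Suc i) x)" for x :: "'x schain"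
    using assms by (auto intro!: T_comm)
  from False assms show ?thesis by (simp add: comm bd_lin P_bd_unfold T_braid algebra_simps)
qed

lemma bd_cycle_34_32:
  assumes "j > i + 2 \<or> j + 1 < i"
  shows "bd n (T j (E (G34 i j)) + E (G34 i j) + asum [i, i+1] (E (G32 j (i+1))) - asum [i+1, i] (E (G32 j i))) = 0"
proof (cases "j > i + 2")
  case True
  then have comm: "T j (T i x) = T i (T j x)" "T j (T (Suc i) x) = T (Suc i) (T j x)" for x :: "'x schain"
    by (auto intro!: T_comm)
  from True show ?thesis by (simp add: comm bd_lin P_bd_unfold T_braid algebra_simps)
next
  case False
  then have comm: "T i (T j x) = T j (T i x)" "T (Suc i) (T j x) = T j (T (Suc i) x)" for x :: "'x schain"
    using assms by (auto intro!: T_comm)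
  from False assms show ?thesis by (simp add: comm bd_lin P_bd_unfold T_braid algebra_simps)
qed

lemma bd_cycle_34_34:
  assumes "j > i + 2"
  shows "bd n (asum [i, i+1] (E (G34 j (i+1))) - asum [i+1, i] (E (G34 j i)) + asum [j, j+1] (E (G34 i (j+1))) - asum [j+1, j] (E (G34 i j))) = 0"
proof -
  have comm: "T j (T i x) = T i (T j x)" "T j (T (Suc i) x) = T (Suc i) (T j x)"
    "T (Suc j) (T i x) = T i (T (Suc j) x)" "T (Suc j) (T (Suc i) x) = T (Suc i) (T (Suc j) x)" for x :: "'x schain"
    using assms by (auto intro!: T_comm)
  from assms show ?thesis by (simp add: comm bd_lin P_bd_unfold T_braid algebra_simps)
qed

lemma bd_cycle_33_first:
  assumes "i + 2 < j" "j + 2 \<le> k"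
  shows "bd n (asum [i, i+1] (E (G33 (i+1) j k)) - asum [i+1, i] (E (G33 i j k))
      - (T j (E (G34 i k)) - E (G34 i k)) + (T k (E (G34 i j)) - E (G34 i j))) = 0"
proof -
  have comm: "T j (T i x) = T i (T j x)" "T j (T (Suc i) x) = T (Suc i) (T j x)"
    "T k (T i x) = T i (T k x)" "T k (T (Suc i) x) = T (Suc i) (T k x)" "T k (T j x) = T j (T k x)"
    for x :: "'x schain"
    using assms by (auto intro!: T_comm)
  from assms show ?thesis by (simp add: comm bd_lin P_bd_unfold T_braid algebra_simps)
qed

lemma bd_cycle_33_middle:
  assumes "i + 2 \<le> j" "j + 2 < k"
  shows "bd n (asum [j, j+1] (E (G33 i (j+1) k)) - asum [j+1, j] (E (G33 i j k))
      + (T i (E (G34 j k)) - E (G34 j k)) - (T k (E (G34 j i)) - E (G34 j i))) = 0"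
proof -
  have comm: "T j (T i x) = T i (T j x)" "T (Suc j) (T i x) = T i (T (Suc j) x)"
    "T k (T i x) = T i (T k x)" "T k (T (Suc j) x) = T (Suc j) (T k x)" "T k (T j x) = T j (T k x)"
    for x :: "'x schain"
    using assms by (auto intro!: T_comm)
  from assms show ?thesis by (simp add: comm bd_lin P_bd_unfold T_braid algebra_simps)
qed

lemma bd_cycle_33_last:
  assumes "i + 2 \<le> j" "j + 2 \<le> k"
  shows "bd n (asum [k, k+1] (E (G33 i j (k+1))) - asum [k+1, k] (E (G33 i j k))
      - (T i (E (G34 k j)) - E (G34 k j)) + (T j (E (G34 k i)) - E (G34 k i))) = 0"
proof -
  have comm: "T j (T i x) = T i (T j x)" "T (Suc k) (T i x) = T i (T (Suc k) x)"
    "T k (T i x) = T i (T k x)" "T (Suc k) (T j x) = T j (T (Suc k) x)" "T k (T j x) = T j (T k x)"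
    for x :: "'x schain"
    using assms by (auto intro!: T_comm)
  from assms show ?thesis by (simp add: comm bd_lin P_bd_unfold T_braid algebra_simps)
qed

text \<open>Cells of type A_3 with one node repeated: i+2 here, whence the factor 1 + s_{i+2} of
  c^{3,7}_i, and i+1 in \<open>bd_cycle_37_36\<close>. In the coinvariants all c^{3,5} terms cancel
  in both.\<close>

lemma bd_cycle_37_32:
  "bd n (E (G37 i) + T (i+2) (E (G37 i)) + T (i+1) (T i (T (i+2) (T (i+1) (E (G32 i (i+2)))))) - E (G32 (i+2) i)
     + T (i+1) (T (i+2) (E (G35 i))) - T i (T (i+1) (T (i+2) (E (G35 i)))) + E (G35 (i+1)) - T i (E (G35 (i+1)))) = 0"
  by (simp add: bd_lin P_bd_unfold T_comm[of i "Suc (Suc i)"] T_braid T_braid3 algebra_simps)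

lemma bd_cycle_37_36:
  "bd n (E (G37 i) + T (i+1) (E (G37 i)) + T i (T (i+1) (E (G32 i (i+2)))) - T (i+2) (T (i+1) (E (G32 (i+2) i)))
     + E (G35 i) - T i (T (i+1) (T (i+2) (T i (E (G35 i)) - E (G36 i))))
     + (T (i+1) (E (G35 (i+1))) - E (G36 (i+1))) - T (i+2) (T (i+1) (T i (E (G35 (i+1)))))) = 0"
  by (simp add: bd_lin P_bd_unfold T_comm[of i "Suc (Suc i)"] T_braid T_braid3 algebra_simps)

text \<open>
  The top cell of type \<open>A\<^sub>4\<close>: each of its four faces occurs with the alternating sum of the minimal
  coset representatives of the parabolic subgroup of that face.
\<close>

lemma bd_cycle_37_37:
  "bd n (asum [i+3, i+2, i+1, i] (E (G37 i)) - asum [i, i+1, i+2, i+3] (E (G37 (i+1)))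
     - (let x = E (G34 i (i+3)); y = T (i+2) x; z = T (i+1) y
        in x - asum [i+3] y + asum [i+3, i+2] z - asum [i+3, i+2, i+1] (T i z))
     + (let x = E (G34 (i+2) i); y = T (i+1) x; z = T (i+2) y
        in x - asum [i] y + asum [i, i+1] z - asum [i, i+1, i+2] (T (i+3) z))) = 0"
  by (simp add: bd_lin P_bd_unfold T_comm[of i "Suc (Suc i)"] T_comm[of i "Suc (Suc (Suc i))"]
      T_comm[of "Suc i" "Suc (Suc (Suc i))"] T_braid T_braid3 T_braid4 numeral_3_eq_3 algebra_simps)

section \<open>Chains with support in a basis\<close>

definition fmod :: "nat \<Rightarrow> 'x cell set \<Rightarrow> 'x schain monoid" where
  "fmod n S = free_mod (sym_group n) S"

lemma fmod_simps [simp]: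
  "x \<in> carrier (fmod n S) \<longleftrightarrow> Poly_Mapping.keys x \<subseteq> {p. p permutes {1..n}} \<times> S"
  "x \<otimes>\<^bsub>fmod n S\<^esub> y = x + y"
  "\<one>\<^bsub>fmod n S\<^esub> = 0"
  by (simp_all add: fmod_def free_mod_def sym_group_def)

lemma comm_group_fmod: "comm_group (fmod n S)"
  by (simp add: fmod_def free_mod_def abelian_free_Abelian_group)

lemma group_fmod: "group (fmod n S)"
  by (rule comm_group.axioms(2)[OF comm_group_fmod])

lemma inv_fmod [simp]: "x \<in> carrier (fmod n S) \<Longrightarrow> inv\<^bsub>fmod n S\<^esub> x = - x"
  by (simp add: fmod_def free_mod_def sym_group_def)

lemma fmod_add: "x \<in> carrier (fmod n S) \<Longrightarrow> y \<in> carrier (fmod n S) \<Longrightarrow> x + y \<in> carrier (fmod n S)"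
  and fmod_minus: "x \<in> carrier (fmod n S) \<Longrightarrow> - x \<in> carrier (fmod n S)"
  and fmod_diff: "x \<in> carrier (fmod n S) \<Longrightarrow> y \<in> carrier (fmod n S) \<Longrightarrow> x - y \<in> carrier (fmod n S)"
  using keys_add[of x y] keys_diff[of x y] by auto

lemma fmod_sact:
  assumes "p permutes {1..n}" "x \<in> carrier (fmod n S)"
  shows "sact p x \<in> carrier (fmod n S)"
  using assms keys_frag_extend[of "\<lambda>(h, b). frag_of (p \<circ> h, b)" x]
  by (fastforce simp: sact_def intro: permutes_compose split: prod.splits)

definition chain :: "nat \<Rightarrow> nat \<Rightarrow> 'x schain set" where
  "chain n k = carrier (fmod n (P_basis n k))"

lemma chain_iff: "x \<in> chain n k \<longleftrightarrow> Poly_Mapping.keys x \<subseteq> {p. p permutes {1..n}} \<times> P_basis n k"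
  by (simp add: chain_def)

lemma chain_0: "0 \<in> chain n k"
  by (simp add: chain_iff)

lemma chain_add: "x \<in> chain n k \<Longrightarrow> y \<in> chain n k \<Longrightarrow> x + y \<in> chain n k"
  and chain_minus: "x \<in> chain n k \<Longrightarrow> - x \<in> chain n k"
  and chain_diff: "x \<in> chain n k \<Longrightarrow> y \<in> chain n k \<Longrightarrow> x - y \<in> chain n k"
  unfolding chain_def by (rule fmod_add fmod_minus fmod_diff; assumption)+

lemma chain_E: "c \<in> P_basis n k \<Longrightarrow> E c \<in> chain n k"
  using permutes_id by (auto simp: chain_iff E_def)

lemma chain_T:
  assumes "0 < i" "i < n" "x \<in> chain n k"
  shows "T i x \<in> chain n k"
  unfolding chain_def T_def
  by (rule fmod_sact[OF _ assms(3)[unfolded chain_def]]) (use assms in \<open>auto intro!: permutes_swap_id\<close>)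

lemma chain_asum: "\<forall>i\<in>set is. 0 < i \<and> i < n \<Longrightarrow> x \<in> chain n k \<Longrightarrow> asum is x \<in> chain n k"
  by (induction "is" arbitrary: x) (auto intro!: chain_diff chain_T)

lemmas chain_intros = chain_add chain_minus chain_diff chain_E chain_T chain_asum

lemma P_basis_3_iff:
  "G31 i \<in> P_basis n 3 \<longleftrightarrow> 1 \<le> i \<and> i \<le> n - 1"
  "G32 i j \<in> P_basis n 3 \<longleftrightarrow> 1 \<le> i \<and> i \<le> n - 1 \<and> 1 \<le> j \<and> j \<le> n - 1 \<and> (i + 2 \<le> j \<or> j + 2 \<le> i)"
  "G33 i j k \<in> P_basis n 3 \<longleftrightarrow> 1 \<le> i \<and> i + 2 \<le> j \<and> j + 2 \<le> k \<and> k \<le> n - 1"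
  "G34 i j \<in> P_basis n 3 \<longleftrightarrow> 1 \<le> i \<and> i \<le> n - 2 \<and> 1 \<le> j \<and> j \<le> n - 1 \<and> (i + 2 < j \<or> j + 1 < i)"
  "G35 i \<in> P_basis n 3 \<longleftrightarrow> 1 \<le> i \<and> i \<le> n - 2"
  "G36 i \<in> P_basis n 3 \<longleftrightarrow> 1 \<le> i \<and> i \<le> n - 2"
  "G37 i \<in> P_basis n 3 \<longleftrightarrow> 1 \<le> i \<and> i \<le> n - 3"
  "Gstar \<notin> P_basis n 3" "Ge i \<notin> P_basis n 3" "Gc i \<notin> P_basis n 3" "Gb i \<notin> P_basis n 3"
  "Gd i j \<notin> P_basis n 3" "Gext x \<notin> P_basis n 3"
  by (auto simp: P_basis_def)

lemma tot_asum: "tot (asum is x) = (if even (length is) then tot x else 0)"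
  by (induction "is" arbitrary: x) (simp_all add: tot_lin)

section \<open>Relations in the coinvariants\<close>

definition bounds :: "nat \<Rightarrow> ('x cell \<Rightarrow>\<^sub>0 int) set" where
  "bounds n = tot ` {x \<in> chain n 3. bd n x = 0}"

lemma bounds_0: "0 \<in> bounds n"
  unfolding bounds_def by (rule image_eqI[where x = 0]) (simp_all add: chain_0)

lemma bounds_add: "u \<in> bounds n \<Longrightarrow> v \<in> bounds n \<Longrightarrow> u + v \<in> bounds n"
  unfolding bounds_def by (force simp: bd_add chain_add simp flip: tot_add)

lemma bounds_minus: "u \<in> bounds n \<Longrightarrow> - u \<in> bounds n"
  unfolding bounds_def by (force simp: bd_minus chain_minus simp flip: tot_minus)

lemma boundsI: "bd n x = 0 \<Longrightarrow> x \<in> chain n 3 \<Longrightarrow> tot x = u \<Longrightarrow> u \<in> bounds n"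
  unfolding bounds_def by blast

section \<open>Congruence modulo boundaries in the coinvariants\<close>

definition eqv :: "nat \<Rightarrow> ('x cell \<Rightarrow>\<^sub>0 int) \<Rightarrow> ('x cell \<Rightarrow>\<^sub>0 int) \<Rightarrow> bool" where
  "eqv n u v \<longleftrightarrow> u - v \<in> bounds n"

lemma eqv_refl [simp]: "eqv n u u"
  by (simp add: eqv_def bounds_0)

lemma eqv_sym: "eqv n u v \<Longrightarrow> eqv n v u"
  using bounds_minus[of "u - v" n] by (simp add: eqv_def)

lemma eqv_trans [trans]: "eqv n u v \<Longrightarrow> eqv n v z \<Longrightarrow> eqv n u z"
  using bounds_add[of "u - v" n "v - z"] by (simp add: eqv_def)

lemma eqv_add: "eqv n u v \<Longrightarrow> eqv n u' v' \<Longrightarrow> eqv n (u + u') (v + v')"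
  using bounds_add[of "u - v" n "u' - v'"] by (simp add: eqv_def algebra_simps)

lemma eqv_minus: "eqv n u v \<Longrightarrow> eqv n (- u) (- v)"
  using bounds_minus[of "u - v" n] by (simp add: eqv_def)

lemma eqv_diff: "eqv n u v \<Longrightarrow> eqv n u' v' \<Longrightarrow> eqv n (u - u') (v - v')"
  using eqv_add[of n u v "- u'" "- v'"] eqv_minus[of n u' v'] by simp

lemma eqv_cmul: "eqv n u v \<Longrightarrow> eqv n (frag_cmul a u) (frag_cmul a v)"
proof (induction a)
  case (nonneg m)
  then show ?case
    by (induction m) (simp_all add: frag_cmul_distrib eqv_add)
next
  case (neg m)
  have "eqv n (frag_cmul (int m) u) (frag_cmul (int m) v)" for m
    using neg by (induction m) (simp_all add: frag_cmul_distrib eqv_add)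
  from eqv_minus[OF this[of "Suc m"]] show ?case
    by simp
qed

abbreviation (input) F :: "'x cell \<Rightarrow> ('x cell \<Rightarrow>\<^sub>0 int)" where "F \<equiv> frag_of"

lemmas tot_simps = tot_lin tot_asum Let_def

lemma eqv_31: "1 \<le> i \<Longrightarrow> i \<le> n - 1 \<Longrightarrow> eqv n (F (G31 i) + F (G31 i)) 0"
  unfolding eqv_def by (rule boundsI[OF bd_cycle_31]) (auto intro!: chain_intros simp: P_basis_3_iff tot_simps)

lemma eqv_31_Suc: "1 \<le> i \<Longrightarrow> i + 1 \<le> n - 1 \<Longrightarrow> eqv n (F (G31 (i+1))) (F (G31 i))"
  unfolding eqv_def by (rule boundsI[OF bd_cycle_35]) (auto intro!: chain_intros simp: P_basis_3_iff tot_simps)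

lemma eqv_36:
  assumes "1 \<le> i" "i \<le> n - 2"
  shows "eqv n (F (G36 i) + F (G36 i) + F (G36 i)) 0"
proof -
  have "F (G36 i) + F (G36 i) + F (G36 i) - (F (G31 i) + F (G31 i) + F (G31 i))
      + (F (G31 (i+1)) + F (G31 (i+1)) + F (G31 (i+1))) \<in> bounds n"
    by (rule boundsI[OF bd_cycle_36]) (use assms in \<open>auto intro!: chain_intros simp: P_basis_3_iff tot_simps\<close>)
  then have "eqv n (F (G36 i) + F (G36 i) + F (G36 i)) (F (G31 i) + F (G31 i) + F (G31 i)
      - (F (G31 (i+1)) + F (G31 (i+1)) + F (G31 (i+1))))"
    by (simp add: eqv_def algebra_simps)
  also have "eqv n \<dots> (F (G31 i) + F (G31 i) + F (G31 i) - (F (G31 i) + F (G31 i) + F (G31 i)))"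
    using assms by (intro eqv_diff eqv_add eqv_refl eqv_31_Suc) auto
  finally show ?thesis
    by simp
qed

lemma eqv_33:
  assumes "1 \<le> i" "i + 2 \<le> j" "j + 2 \<le> k" "k \<le> n - 1"
  shows "eqv n (F (G33 i j k) + F (G33 i j k)) 0"
  unfolding eqv_def by (rule boundsI[OF bd_cycle_33[of i j k]]) (use assms in \<open>auto intro!: chain_intros simp: P_basis_3_iff tot_simps\<close>)

lemma eqv_33_first:
  assumes "1 \<le> i" "i + 2 < j" "j + 2 \<le> k" "k \<le> n - 1"
  shows "eqv n (F (G33 (i+1) j k)) (F (G33 i j k))"
  unfolding eqv_def by (rule boundsI[OF bd_cycle_33_first[of i j k]]) (use assms in \<open>auto intro!: chain_intros simp: P_basis_3_iff tot_simps\<close>)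

lemma eqv_33_middle:
  assumes "1 \<le> i" "i + 2 \<le> j" "j + 2 < k" "k \<le> n - 1"
  shows "eqv n (F (G33 i (j+1) k)) (F (G33 i j k))"
  unfolding eqv_def by (rule boundsI[OF bd_cycle_33_middle[of i j k]]) (use assms in \<open>auto intro!: chain_intros simp: P_basis_3_iff tot_simps\<close>)

lemma eqv_33_last:
  assumes "1 \<le> i" "i + 2 \<le> j" "j + 2 \<le> k" "k + 1 \<le> n - 1"
  shows "eqv n (F (G33 i j (k+1))) (F (G33 i j k))"
  unfolding eqv_def by (rule boundsI[OF bd_cycle_33_last[of i j k]]) (use assms in \<open>auto intro!: chain_intros simp: P_basis_3_iff tot_simps\<close>)

lemma eqv_32_first:
  assumes "1 \<le> i" "i + 1 \<le> n - 1" "1 \<le> j" "j \<le> n - 1" "i + 2 < j \<or> j + 1 < i"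
  shows "eqv n (F (G32 (i+1) j)) (F (G32 i j) + (F (G34 i j) + F (G34 i j)))"
  unfolding eqv_def
  by (rule boundsI[OF bd_cycle_35_34[of i j]]) (use assms in \<open>auto intro!: chain_intros simp: P_basis_3_iff tot_simps\<close>)

lemma eqv_32_second:
  assumes "1 \<le> i" "i + 1 \<le> n - 1" "1 \<le> j" "j \<le> n - 1" "i + 2 < j \<or> j + 1 < i"
  shows "eqv n (F (G32 j (i+1))) (F (G32 j i) - (F (G34 i j) + F (G34 i j)))"
  unfolding eqv_def
  by (rule boundsI[OF bd_cycle_34_32[of i j]]) (use assms in \<open>auto intro!: chain_intros simp: P_basis_3_iff tot_simps\<close>)

lemma eqv_32_swap:
  assumes "1 \<le> i" "i + 2 \<le> j" "j \<le> n - 1"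
  shows "eqv n (F (G32 i j) + F (G32 i j) + (F (G32 j i) + F (G32 j i))) 0"
  unfolding eqv_def by (rule boundsI[OF bd_cycle_32_swap[of i j]]) (use assms in \<open>auto intro!: chain_intros simp: P_basis_3_iff tot_simps\<close>)

lemma eqv_34_square:
  assumes "1 \<le> i" "i + 2 < j" "j + 1 \<le> n - 1"
  shows "eqv n (F (G34 j (i+1)) + F (G34 i (j+1))) (F (G34 j i) + F (G34 i j))"
  unfolding eqv_def by (rule boundsI[OF bd_cycle_34_34[of i j]]) (use assms in \<open>auto intro!: chain_intros simp: P_basis_3_iff tot_simps\<close>)

lemma eqv_37_32:
  assumes "1 \<le> i" "i + 2 \<le> n - 1"
  shows "eqv n (F (G32 (i+2) i)) (F (G32 i (i+2)) + (F (G37 i) + F (G37 i)))"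
proof (rule eqv_sym)
  show "eqv n (F (G32 i (i+2)) + (F (G37 i) + F (G37 i))) (F (G32 (i+2) i))"
    unfolding eqv_def by (rule boundsI[OF bd_cycle_37_32[of n i]]) (use assms in \<open>auto intro!: chain_intros simp: P_basis_3_iff tot_simps\<close>)
qed

text \<open>The two cells of type A_3 have the same c^{3,7} and c^{3,2} parts in the coinvariants;
  their difference compares the c^{3,6} parts alone.\<close>

lemma eqv_36_Suc:
  assumes "1 \<le> i" "i + 2 \<le> n - 1"
  shows "eqv n (F (G36 (i+1))) (F (G36 i))"
proof -
  have "F (G37 i) + F (G37 i) + F (G32 i (i+2)) - F (G32 (i+2) i) + F (G36 i) - F (G36 (i+1)) \<in> bounds n"
    by (rule boundsI[OF bd_cycle_37_36[of n i]]) (use assms in \<open>auto intro!: chain_intros simp: P_basis_3_iff tot_simps\<close>)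
  from bounds_add[OF this eqv_37_32[OF assms, unfolded eqv_def]] show ?thesis
    by (intro eqv_sym[of n "F (G36 i)"]) (simp add: eqv_def algebra_simps)
qed

text \<open>In \<open>bd_cycle_37_37\<close> each c^{3,7} has five coset representatives, with
  signed count 1. Each c^{3,4} has ten, those of a parabolic S_3 x S_2 in S_5: six even and four
  odd, hence the coefficient 2.\<close>

lemma eqv_37_Suc:
  assumes "1 \<le> i" "i + 3 \<le> n - 1"
  shows "eqv n (F (G37 (i+1)))
    (F (G37 i) - (F (G34 i (i+3)) + F (G34 i (i+3))) + (F (G34 (i+2) i) + F (G34 (i+2) i)))"
proof (rule eqv_sym)
  show "eqv n (F (G37 i) - (F (G34 i (i+3)) + F (G34 i (i+3))) + (F (G34 (i+2) i) + F (G34 (i+2) i)))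
    (F (G37 (i+1)))"
    unfolding eqv_def by (rule boundsI[OF bd_cycle_37_37[of n i, unfolded Let_def]]) (use assms in \<open>auto intro!: chain_intros simp: P_basis_3_iff tot_simps\<close>)
qed

text \<open>
  A path of cells \<open>c\<^bsup>3,4\<^esup>\<close> from \<open>d\<^sub>1\<^sub>3\<close> to \<open>d\<^sub>i\<^sub>j\<close>: its boundary in the coinvariants is
  \<open>d\<^sub>i\<^sub>j - d\<^sub>1\<^sub>3\<close>.
\<close>

definition dpath :: "nat \<Rightarrow> nat \<Rightarrow> ('x cell \<Rightarrow>\<^sub>0 int)" where
  "dpath i j = (\<Sum>k=3..<j. frag_of (G34 k 1)) - (\<Sum>k=1..<i. frag_of (G34 k j))"

lemma dpath_1_3 [simp]: "dpath (Suc 0) 3 = 0" "dpath (Suc 0) (Suc (Suc (Suc 0))) = 0"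
  by (simp_all add: dpath_def)

lemma dpath_1_Suc: "3 \<le> j \<Longrightarrow> dpath (Suc 0) (Suc j) = dpath (Suc 0) j + F (G34 j (Suc 0))"
  by (simp add: dpath_def)

lemma dpath_Suc: "1 \<le> i \<Longrightarrow> dpath (Suc i) j = dpath i j - F (G34 i j)"
  by (simp add: dpath_def)

text \<open>Independence of the path: \<open>dpath\<close> increases the second index only while the
  first is 1. The squares b_i x b_j push such an edge to any first index j.\<close>

lemma eqv_34_right:
  assumes "1 \<le> j" "j + 1 < i" "i + 1 \<le> n - 1"
  shows "eqv n (F (G34 i j) :: 'x cell \<Rightarrow>\<^sub>0 int) (dpath j (i+1) - dpath j i)"
  using assms(1,2)
proof (induction j rule: dec_induct)
  case base
  then show ?case by (simp add: dpath_1_Suc)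
next
  case (step j)
  have "eqv n (F (G34 i (j+1)) :: 'x cell \<Rightarrow>\<^sub>0 int) (F (G34 i j) + F (G34 j i) - F (G34 j (i+1)))"
    using eqv_34_square[of j i n, where 'a = 'x] step assms by (simp add: eqv_def algebra_simps)
  also have "eqv n \<dots> (dpath j (i+1) - dpath j i + F (G34 j i) - F (G34 j (i+1)))"
    using step by (intro eqv_diff eqv_add eqv_refl) auto
  also have "\<dots> = dpath (j+1) (i+1) - dpath (j+1) i"
    using step by (simp add: dpath_Suc)
  finally show ?case by simp
qed

text \<open>In the coinvariants c^{3,2}_ij has boundary -2 d_ij, so each edge of the path from d_13
  to d_ij is subtracted twice. With the indices exchanged the boundary is +2 d_ij and the sign
  changes, as in \<open>eqv_32_greater\<close>.\<close>

lemma eqv_32_less: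
  assumes "1 \<le> i" "i + 2 \<le> j" "j \<le> n - 1"
  shows "eqv n (F (G32 i j) :: 'x cell \<Rightarrow>\<^sub>0 int) (F (G32 1 3) - (dpath i j + dpath i j))"
  using assms(1,2)
proof (induction i rule: dec_induct)
  case base
  then have "3 \<le> j" by simp
  then show ?case using assms(3)
  proof (induction j rule: dec_induct)
    case (step j)
    have "eqv n (F (G32 1 (j+1)) :: 'x cell \<Rightarrow>\<^sub>0 int) (F (G32 1 j) - (F (G34 j 1) + F (G34 j 1)))"
      using step by (intro eqv_32_second) auto
    also have "eqv n \<dots> (F (G32 1 3) - (dpath 1 j + dpath 1 j) - (F (G34 j 1) + F (G34 j 1)))"
      using step by (intro eqv_diff eqv_refl) auto
    also have "\<dots> = F (G32 1 3) - (dpath 1 (j+1) + dpath 1 (j+1))"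
      using step by (simp add: dpath_1_Suc algebra_simps)
    finally show ?case by simp
  qed simp
next
  case (step i)
  have "eqv n (F (G32 (i+1) j) :: 'x cell \<Rightarrow>\<^sub>0 int) (F (G32 i j) + (F (G34 i j) + F (G34 i j)))"
    using step assms by (intro eqv_32_first) auto
  also have "eqv n \<dots> (F (G32 1 3) - (dpath i j + dpath i j) + (F (G34 i j) + F (G34 i j)))"
    using step by (intro eqv_add eqv_refl) auto
  also have "\<dots> = F (G32 1 3) - (dpath (i+1) j + dpath (i+1) j)"
    using step by (simp add: dpath_Suc algebra_simps)
  finally show ?case by simp
qed

lemma eqv_32_greater:
  assumes "1 \<le> i" "i + 2 \<le> j" "j \<le> n - 1"
  shows "eqv n (F (G32 j i) :: 'x cell \<Rightarrow>\<^sub>0 int) (F (G32 1 3) + (F (G37 1) + F (G37 1)) + (dpath i j + dpath i j))"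
  using assms(1,2)
proof (induction i rule: dec_induct)
  case base
  then have "3 \<le> j" by simp
  then show ?case using assms(3)
  proof (induction j rule: dec_induct)
    case base
    then show ?case using eqv_37_32[of 1 n, where 'a = 'x] by (simp add: numeral_3_eq_3)
  next
    case (step j)
    have "eqv n (F (G32 (j+1) 1) :: 'x cell \<Rightarrow>\<^sub>0 int) (F (G32 j 1) + (F (G34 j 1) + F (G34 j 1)))"
      using step by (intro eqv_32_first) auto
    also have "eqv n \<dots> (F (G32 1 3) + (F (G37 1) + F (G37 1)) + (dpath 1 j + dpath 1 j) + (F (G34 j 1) + F (G34 j 1)))"
      using step by (intro eqv_add[of n "F (G32 j 1)"] eqv_refl) auto
    also have "\<dots> = F (G32 1 3) + (F (G37 1) + F (G37 1)) + (dpath 1 (j+1) + dpath 1 (j+1))"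
      using step by (simp add: dpath_1_Suc algebra_simps)
    finally show ?case by simp
  qed
next
  case (step i)
  have "eqv n (F (G32 j (i+1)) :: 'x cell \<Rightarrow>\<^sub>0 int) (F (G32 j i) - (F (G34 i j) + F (G34 i j)))"
    using step assms by (intro eqv_32_second) auto
  also have "eqv n \<dots> (F (G32 1 3) + (F (G37 1) + F (G37 1)) + (dpath i j + dpath i j) - (F (G34 i j) + F (G34 i j)))"
    using step by (intro eqv_diff eqv_refl) auto
  also have "\<dots> = F (G32 1 3) + (F (G37 1) + F (G37 1)) + (dpath (i+1) j + dpath (i+1) j)"
    using step by (simp add: dpath_Suc algebra_simps)
  finally show ?case by simp
qed

text \<open>The two c^{3,4} corrections in \<open>eqv_37_Suc\<close> form a path from d_{i,i+2} over
  d_{i,i+3} to d_{i+1,i+3}, and the boundary of c^{3,7}_i is 2 d_{i,i+2}.\<close>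

lemma eqv_37_1:
  assumes "1 \<le> i" "i + 2 \<le> n - 1"
  shows "eqv n (F (G37 i) :: 'x cell \<Rightarrow>\<^sub>0 int) (F (G37 1) + (dpath i (i+2) + dpath i (i+2)))"
  using assms
proof (induction i rule: dec_induct)
  case base
  then show ?case by (simp add: numeral_3_eq_3[symmetric])
next
  case (step i)
  have "eqv n (F (G37 (i+1)) :: 'x cell \<Rightarrow>\<^sub>0 int)
      (F (G37 i) - (F (G34 i (i+3)) + F (G34 i (i+3))) + (F (G34 (i+2) i) + F (G34 (i+2) i)))"
    using step by (intro eqv_37_Suc) auto
  also have "eqv n \<dots> (F (G37 1) + (dpath i (i+2) + dpath i (i+2)) - (F (G34 i (i+3)) + F (G34 i (i+3)))
      + ((dpath i (i+2+1) - dpath i (i+2)) + (dpath i (i+2+1) - dpath i (i+2))))"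
    using step by (intro eqv_diff eqv_add[of n "F (G37 i) - _"] eqv_add[of n "F (G34 (i+2) i)"] eqv_refl eqv_34_right) auto
  also have "\<dots> = F (G37 1) + (dpath (i+1) (i+3) + dpath (i+1) (i+3))"
    using step by (simp add: dpath_Suc numeral_3_eq_3 algebra_simps)
  finally show ?case by (simp add: numeral_3_eq_3)
qed

lemma eqv_31_1:
  assumes "1 \<le> i" "i \<le> n - 1"
  shows "eqv n (F (G31 i) :: 'x cell \<Rightarrow>\<^sub>0 int) (F (G31 1))"
  using assms
proof (induction i rule: dec_induct)
  case (step i)
  then show ?case by (auto intro: eqv_trans[OF eqv_31_Suc[simplified]])
qed simp

lemma eqv_36_1:
  assumes "1 \<le> i" "i \<le> n - 2"
  shows "eqv n (F (G36 i) :: 'x cell \<Rightarrow>\<^sub>0 int) (F (G36 1))"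
  using assms
proof (induction i rule: dec_induct)
  case (step i)
  then show ?case by (auto intro: eqv_trans[OF eqv_36_Suc[simplified]])
qed simp

lemma eqv_33_135:
  assumes "1 \<le> i" "i + 2 \<le> j" "j + 2 \<le> k" "k \<le> n - 1"
  shows "eqv n (F (G33 i j k) :: 'x cell \<Rightarrow>\<^sub>0 int) (F (G33 1 3 5))"
proof -
  have "eqv n (F (G33 i j k) :: 'x cell \<Rightarrow>\<^sub>0 int) (F (G33 1 j k))"
    using assms(1,2)
  proof (induction i rule: dec_induct)
    case (step i)
    then show ?case using assms by (auto intro: eqv_trans[OF eqv_33_first[simplified]])
  qed simp
  also have "eqv n \<dots> (F (G33 1 3 k))"
  proof -
    have "3 \<le> j" using assms by simp
    then show ?thesis using assms(3)
    proof (induction j rule: dec_induct)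
      case (step j)
      then show ?case using assms by (auto intro: eqv_trans[OF eqv_33_middle[simplified]])
    qed simp
  qed
  also have "eqv n \<dots> (F (G33 1 3 5))"
  proof -
    have "5 \<le> k" using assms by simp
    then show ?thesis using assms(4)
    proof (induction k rule: dec_induct)
      case (step k)
      then show ?case using assms by (auto intro: eqv_trans[OF eqv_33_last[simplified]])
    qed simp
  qed
  finally show ?thesis .
qed

section \<open>Normal forms of 3-cells modulo boundaries\<close>

fun dpath_ext :: "'x cell \<Rightarrow> ('x cell \<Rightarrow>\<^sub>0 int)" where
  "dpath_ext (Gd i j) = dpath i j"
| "dpath_ext _ = 0"

fun nf :: "'x cell \<Rightarrow> ('x cell \<Rightarrow>\<^sub>0 int)" where
  "nf (G31 i) = F (G31 1)"
| "nf (G32 i j) = F (G32 1 3) + (if i < j then 0 else F (G37 1) + F (G37 1))"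
| "nf (G33 i j k) = F (G33 1 3 5)"
| "nf (G36 i) = F (G36 1)"
| "nf (G37 i) = F (G37 1)"
| "nf _ = 0"

text \<open>The boundary induced on the coinvariants. The index 0 is arbitrary by
  \<open>P_bd_indep\<close>.\<close>

definition dbar :: "('x cell \<Rightarrow>\<^sub>0 int) \<Rightarrow> ('x cell \<Rightarrow>\<^sub>0 int)" where
  "dbar = frag_extend (\<lambda>c. tot (P_bd 0 c))"

lemma P_bd_indep: "P_bd n c = P_bd 0 c"
  by (cases c) (simp_all only: P_bd.simps P_bd_unfold split: if_splits)

lemma tot_bd: "tot (bd n x) = dbar (tot x)"
proof (induction x rule: frag_induction[OF subset_UNIV])
  case (2 x)
  obtain p c where x: "x = (p, c)" by (cases x)
  have "bd n (frag_of x) = sact p (P_bd 0 c)"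
    by (simp add: x bd_def lin_ext_def gact_sym_group P_bd_indep[of n])
  then show ?case
    by (simp add: x dbar_def tot_sact) (simp add: tot_def)
qed (simp_all add: bd_diff tot_diff dbar_def frag_extend_diff)

lemma dbar_add: "dbar (u + v) = dbar u + dbar v"
  and dbar_diff: "dbar (u - v) = dbar u - dbar v"
  and dbar_cmul: "dbar (frag_cmul k u) = frag_cmul k (dbar u)"
  and dbar_0 [simp]: "dbar 0 = 0"
  by (simp_all add: dbar_def frag_extend_add frag_extend_diff frag_extend_cmul)

lemma dbar_frag_of:
  "dbar (F (G31 i)) = 0"
  "dbar (F (G32 i j)) = (if i < j then - (F (Gd i j) + F (Gd i j)) else F (Gd j i) + F (Gd j i))"
  "dbar (F (G33 i j k)) = 0"
  "dbar (F (G34 i j)) = (if i + 2 < j then F (Gd i j) - F (Gd (i+1) j) else F (Gd j (i+1)) - F (Gd j i))"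
  "dbar (F (G35 i)) = F (Gb i) + F (Gb i) - F (Gc (i+1)) + F (Gc i)"
  "dbar (F (G36 i)) = 0"
  "dbar (F (G37 i)) = F (Gd i (i+2)) + F (Gd i (i+2))"
  by (simp_all add: dbar_def P_bd_unfold tot_simps T_lin algebra_simps)

lemma dbar_bounds: "u \<in> bounds n \<Longrightarrow> dbar u = 0"
  by (auto simp: bounds_def tot_bd[of n, symmetric])

text \<open>\<open>dpath_ext\<close> carries the d_ij in the boundary of a cell back to d_13, and
  \<open>nf\<close> is what remains of the cell. A c^{3,4} is itself an edge, or congruent to a
  difference of paths, so nothing remains of it. The correction is linear in the boundary and
  disappears on cycles. The cells c^{3,5} are left out because their boundaries involve b_i and
  c_i.\<close>

lemma eqv_nf:
  assumes "c \<in> P_basis n 3" "c \<notin> range G35"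
  shows "eqv n (F c :: 'x cell \<Rightarrow>\<^sub>0 int) (nf c + frag_extend dpath_ext (dbar (F c)))"
proof (cases c)
  case (G31 i)
  then show ?thesis using assms eqv_31_1[of i n, where 'x = 'x] by (simp add: dbar_frag_of P_basis_3_iff)
next
  case (G32 i j)
  show ?thesis
  proof (cases "i < j")
    case True
    then show ?thesis using assms G32 eqv_32_less[of i j n, where 'x = 'x]
      by (simp add: dbar_frag_of P_basis_3_iff frag_extend_minus frag_extend_diff algebra_simps)
  next
    case False
    then show ?thesis using assms G32 eqv_32_greater[of j i n, where 'x = 'x]
      by (simp add: dbar_frag_of P_basis_3_iff frag_extend_add)
  qed
next
  case (G33 i j k)
  then show ?thesis using assms eqv_33_135[of i j k n, where 'x = 'x] by (simp add: dbar_frag_of P_basis_3_iff)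
next
  case (G34 i j)
  show ?thesis
  proof (cases "i + 2 < j")
    case True
    then show ?thesis using assms G34
      by (simp add: dpath_Suc dbar_frag_of P_basis_3_iff frag_extend_diff)
  next
    case False
    have "i + 1 \<le> n - 1" using assms G34 by (simp add: P_basis_3_iff) arith
    then show ?thesis using False assms G34 eqv_34_right[of j i n, where 'x = 'x]
      by (simp add: dbar_frag_of P_basis_3_iff frag_extend_diff)
  qed
next
  case (G36 i)
  then show ?thesis using assms eqv_36_1[of i n, where 'x = 'x] by (simp add: dbar_frag_of P_basis_3_iff)
next
  case (G37 i)
  have "i + 2 \<le> n - 1" using assms G37 by (simp add: P_basis_3_iff) arith
  then show ?thesis using G37 assms eqv_37_1[of i n, where 'x = 'x]
    by (simp add: dbar_frag_of P_basis_3_iff frag_extend_add)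
qed (use assms in \<open>auto simp: P_basis_3_iff\<close>)

lemma frag_cmul_2: "frag_cmul 2 x = x + x"
  using frag_cmul_distrib[of 1 1 x] by simp

definition comb :: "int \<Rightarrow> int \<Rightarrow> int \<Rightarrow> int \<Rightarrow> ('x cell \<Rightarrow>\<^sub>0 int)" where
  "comb a b c d = frag_cmul a (F (G31 1)) + frag_cmul b (F (G33 1 3 5)) + frag_cmul c (F (G36 1))
     + frag_cmul d (F (G37 1) + F (G32 1 3))"

text \<open>Only c^{3,5}_i has b_i in its boundary, so it cannot occur in a cycle of the
  coinvariants.\<close>

lemma lookup_dbar_Gb:
  assumes "Poly_Mapping.keys u \<subseteq> P_basis n 3"
  shows "Poly_Mapping.lookup (dbar u) (Gb i) = 2 * Poly_Mapping.lookup u (G35 i)"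
  using assms
proof (induction u rule: frag_induction)
  case (one c)
  then show ?case
    by (cases c) (auto simp: dbar_frag_of P_basis_3_iff lookup_add lookup_minus)
qed (simp_all add: dbar_diff lookup_minus)

lemma nf_span:
  fixes u :: "'x cell \<Rightarrow>\<^sub>0 int"
  assumes "Poly_Mapping.keys u \<subseteq> P_basis n 3 - range G35"
  shows "\<exists>a b c d e. frag_extend nf u = comb a b c d + frag_cmul e (F (G37 1))"
  using assms
proof (induction u rule: frag_induction)
  case zero
  show ?case by (rule exI[of _ 0])+ (simp add: comb_def)
next
  case (one x)
  have 1: "\<exists>a b c d e. nf x = frag_cmul a (F (G31 1)) + frag_cmul b (F (G33 1 3 5)) + frag_cmul c (F (G36 1))
     + frag_cmul d (F (G32 1 3)) + frag_cmul e (F (G37 1))"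
  proof -
    define S where "S a b c d e = frag_cmul a (F (G31 1 :: 'x cell)) + frag_cmul b (F (G33 1 3 5)) + frag_cmul c (F (G36 1))
     + frag_cmul d (F (G32 1 3)) + frag_cmul e (F (G37 1))" for a b c d e :: int
    have *: "F (G31 1) = S 1 0 0 0 0" "F (G33 1 3 5) = S 0 1 0 0 0" "F (G36 1) = S 0 0 1 0 0"
      "F (G32 1 3) = S 0 0 0 1 0" "F (G32 1 3) + (F (G37 1) + F (G37 1)) = S 0 0 0 1 2"
      "F (G37 1) = S 0 0 0 0 1" "0 = S 0 0 0 0 0"
      by (simp_all add: S_def frag_cmul_2)
    have "nf x \<in> {S 1 0 0 0 0, S 0 1 0 0 0, S 0 0 1 0 0, S 0 0 0 1 0, S 0 0 0 1 2, S 0 0 0 0 1, S 0 0 0 0 0}"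
      unfolding *[symmetric] by (cases x) auto
    then show ?thesis unfolding S_def by blast
  qed
  then obtain a b c d e where "nf x = frag_cmul a (F (G31 1)) + frag_cmul b (F (G33 1 3 5)) + frag_cmul c (F (G36 1))
     + frag_cmul d (F (G32 1 3)) + frag_cmul e (F (G37 1))" by blast
  \<comment> \<open>c^{3,2}_13 is rewritten as (c^{3,7}_1 + c^{3,2}_13) - c^{3,7}_1, which shifts
    the last coefficient by -d.\<close>
  then have "frag_extend nf (F x) = comb a b c d + frag_cmul (e - d) (F (G37 1))"
    by (simp add: comb_def frag_cmul_distrib2 frag_cmul_diff_distrib)
  then show ?case by blast
next
  case (diff u v)
  then obtain a b c d e a' b' c' d' e' where
    "frag_extend nf u = comb a b c d + frag_cmul e (F (G37 1))"
    "frag_extend nf v = comb a' b' c' d' + frag_cmul e' (F (G37 1))" by blast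
  then have "frag_extend nf (u - v) = comb (a - a') (b - b') (c - c') (d - d') + frag_cmul (e - e') (F (G37 1))"
    by (simp add: frag_extend_diff comb_def frag_cmul_diff_distrib)
  then show ?case by blast
qed

lemma dbar_comb [simp]: "dbar (comb a b c d) = 0"
  by (simp add: comb_def dbar_add dbar_cmul dbar_frag_of numeral_3_eq_3)

lemma eqv_comb:
  fixes u :: "'x cell \<Rightarrow>\<^sub>0 int"
  assumes keys: "Poly_Mapping.keys u \<subseteq> P_basis n 3" and "dbar u = 0"
  shows "\<exists>a b c d. eqv n u (comb a b c d)"
proof -
  have "Poly_Mapping.lookup u (G35 i) = 0" for i
    using lookup_dbar_Gb[OF keys, of i] assms by simp
  then have keys': "Poly_Mapping.keys u \<subseteq> P_basis n 3 - range G35"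
    using keys by (auto simp: in_keys_iff)
  then have "eqv n u (frag_extend nf u + frag_extend dpath_ext (dbar u))"
  proof (induction u rule: frag_induction)
    case (one c)
    then show ?case using eqv_nf[of c n] by simp
  next
    case (diff u v)
    from eqv_diff[OF this] show ?case
      by (simp add: frag_extend_diff dbar_diff algebra_simps)
  qed simp
  moreover obtain a b c d e where nf: "frag_extend nf u = comb a b c d + frag_cmul e (F (G37 1))"
    using nf_span[OF keys'] by blast
  ultimately have eqv: "eqv n u (comb a b c d + frag_cmul e (F (G37 1)))"
    using assms by simp
  \<comment> \<open>Congruent chains have equal boundaries. The surplus multiple of c^{3,7}_1 has
    boundary 2e d_13, which forces e = 0.\<close>
  then have "dbar (u - (comb a b c d + frag_cmul e (F (G37 1)))) = 0"
    unfolding eqv_def by (rule dbar_bounds)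
  moreover have "dbar (u - (comb a b c d + frag_cmul e (F (G37 1)))) = - frag_cmul e (F (Gd 1 3) + F (Gd 1 3))"
    using assms(2) by (simp add: dbar_diff dbar_add dbar_cmul dbar_frag_of numeral_3_eq_3 del: minus_frag_cmul)
  ultimately have "frag_cmul e (frag_cmul 2 (F (Gd 1 3 :: 'x cell))) = 0"
    by (simp add: frag_cmul_2)
  then have "e = 0" by simp
  with eqv show ?thesis by auto
qed

text \<open>4 (c^{3,7}_1 + c^{3,2}_13) regroups as 2 c^{3,2}_13 + 2 (c^{3,2}_13 + 2 c^{3,7}_1). The
  bracket is congruent to c^{3,2}_31, and the cell c_1 x c_3 kills the sum.\<close>

lemma eqv_order4:
  assumes "4 \<le> n"
  shows "eqv n (frag_cmul 4 (F (G37 1) + F (G32 1 3) :: 'x cell \<Rightarrow>\<^sub>0 int)) 0"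
proof -
  have 4: "frag_cmul 4 x = x + x + (x + x)" for x :: "'x cell \<Rightarrow>\<^sub>0 int"
    using frag_cmul_distrib[of 2 2 x] by (simp add: frag_cmul_2)
  have swap: "eqv n (F (G32 1 3) + F (G32 1 3) + (F (G32 3 1) + F (G32 3 1) :: 'x cell \<Rightarrow>\<^sub>0 int)) 0"
    using assms by (intro eqv_32_swap) auto
  have 31: "eqv n (F (G32 1 3) + (F (G37 1) + F (G37 1))) (F (G32 3 1) :: 'x cell \<Rightarrow>\<^sub>0 int)"
    using eqv_sym[OF eqv_37_32[of 1 n, where 'a = 'x]] assms by (simp add: numeral_3_eq_3)
  have "frag_cmul 4 (F (G37 1) + F (G32 1 3) :: 'x cell \<Rightarrow>\<^sub>0 int) = F (G32 1 3) + F (G32 1 3)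
      + ((F (G32 1 3) + (F (G37 1) + F (G37 1))) + (F (G32 1 3) + (F (G37 1) + F (G37 1))))"
    unfolding 4 by (simp add: algebra_simps)
  also have "eqv n \<dots> (F (G32 1 3) + F (G32 1 3) + (F (G32 3 1) + F (G32 3 1)))"
    by (intro eqv_add 31 eqv_refl)
  also note swap
  finally show ?thesis .
qed

lemma comb_cong:
  assumes "6 \<le> n" "2 dvd a - a'" "2 dvd b - b'" "3 dvd c - c'" "4 dvd d - d'"
  shows "eqv n (comb a b c d) (comb a' b' c' d')"
proof -
  have 3: "frag_cmul 3 x = x + x + x" for x :: "'x cell \<Rightarrow>\<^sub>0 int"
    using frag_cmul_distrib[of 2 1 x] by (simp add: frag_cmul_2)
  have *: "eqv n (frag_cmul k x) (frag_cmul l x)"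
    if ord: "eqv n (frag_cmul m x) 0" and dvd: "m dvd k - l" for k l m :: int and x :: "'x cell \<Rightarrow>\<^sub>0 int"
  proof -
    obtain t where "k - l = m * t"
      using dvd by (elim dvdE)
    then have "k = l + t * m"
      by (simp add: algebra_simps)
    with eqv_cmul[OF ord, of t] show ?thesis
      by (simp add: eqv_def frag_cmul_distrib)
  qed
  show ?thesis
    unfolding comb_def
    by (intro eqv_add *[OF _ assms(2)] *[OF _ assms(3)] *[OF _ assms(4)] *[OF _ assms(5)] eqv_order4)
       (use assms(1) in \<open>auto simp: frag_cmul_2 3 intro!: eqv_31 eqv_33 eqv_36\<close>)
qed

section \<open>Cocycles\<close>

definition evl :: "('b \<Rightarrow> int) \<Rightarrow> ('b \<Rightarrow>\<^sub>0 int) \<Rightarrow> int" where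
  "evl f x = (\<Sum>b\<in>Poly_Mapping.keys x. Poly_Mapping.lookup x b * f b)"

lemma evl_superset:
  "finite A \<Longrightarrow> Poly_Mapping.keys x \<subseteq> A \<Longrightarrow> evl f x = (\<Sum>b\<in>A. Poly_Mapping.lookup x b * f b)"
  unfolding evl_def by (rule sum.mono_neutral_left) (auto simp: in_keys_iff)

lemma evl_0 [simp]: "evl f 0 = 0"
  by (simp add: evl_def)

lemma evl_of [simp]: "evl f (frag_of b) = f b"
  by (simp add: evl_def)

lemma evl_add: "evl f (x + y) = evl f x + evl f y"
proof -
  let ?A = "Poly_Mapping.keys x \<union> Poly_Mapping.keys y"
  have "finite ?A" by simp
  then show ?thesis
    using keys_add[of x y]
    by (simp add: evl_superset[of ?A] lookup_add distrib_right sum.distrib)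
qed

lemma evl_minus: "evl f (- x) = - evl f x"
  by (simp add: evl_def sum_negf)

lemma evl_diff: "evl f (x - y) = evl f x - evl f y"
  using evl_add[of f x "- y"] by (simp add: evl_minus)

lemma evl_cmul: "evl f (frag_cmul k x) = k * evl f x"
  using evl_superset[of "Poly_Mapping.keys x" "frag_cmul k x" f] keys_cmul[of k x]
  by (simp add: evl_def sum_distrib_left mult.assoc)

lemma dvd_evl_bounds:
  fixes u :: "'x cell \<Rightarrow>\<^sub>0 int"
  assumes g: "\<And>\<sigma> c. \<sigma> permutes {1..n} \<Longrightarrow> c \<in> P_basis n 3 \<Longrightarrow> m dvd evl g (sact \<sigma> (P_bd n c)) - f c"
    and "u \<in> bounds n"
  shows "m dvd evl f u"
proof -
  have "m dvd evl g (bd n x) - evl f (tot x)" if "x \<in> chain n 3" for x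
    using that unfolding chain_iff
  proof (induction x rule: frag_induction)
    case (one x)
    obtain \<sigma> c where x: "x = (\<sigma>, c)" by (cases x)
    have "bd n (frag_of x) = sact \<sigma> (P_bd n c)" "tot (frag_of x) = frag_of c"
      by (simp_all add: x bd_def lin_ext_def gact_sym_group tot_def)
    then show ?case using g[of \<sigma> c] one by (simp add: x)
  next
    case (diff x y)
    from dvd_diff[OF this] show ?case
      by (simp add: bd_diff tot_diff evl_diff algebra_simps)
  qed simp
  moreover obtain x where "x \<in> chain n 3" "bd n x = 0" "u = tot x"
    using \<open>u \<in> bounds n\<close> unfolding bounds_def by blast
  ultimately show ?thesis
    using dvd_minus_iff[of m "evl f u"] by fastforce
qed

lemma evl_E: "evl g (sact \<sigma> (E c)) = g (\<sigma>, c)"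
  by (simp add: E_def sact_def)

lemma evl_T: "evl g (sact \<sigma> (T i x)) = evl g (sact (\<sigma> \<circ> transpose i (i + 1)) x)"
  by (simp add: sact_T)

lemmas evl_simps = sact_add sact_diff sact_minus evl_add evl_diff evl_minus evl_E evl_T T_lin

section \<open>The four cocycles and their primitives on P_2\<close>

fun cocycle31 :: "'x cell \<Rightarrow> int" where
  "cocycle31 (G31 i) = 1" | "cocycle31 _ = 0"

text \<open>s_i reverses the order of \<sigma> i and \<sigma> (i+1), which gives an odd value on the
  boundary of c^{3,1}_i. In the boundaries of c^{3,5} and c^{3,6} the c terms compare the same pairs
  of positions with opposite signs.\<close>

fun cochain31 :: "(nat \<Rightarrow> nat) \<times> 'x cell \<Rightarrow> int" where
  "cochain31 (\<sigma>, Gc i) = of_bool (\<sigma> i < \<sigma> (i + 1))" | "cochain31 _ = 0"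

fun cocycle36 :: "'x cell \<Rightarrow> int" where
  "cocycle36 (G36 i) = 1" | "cocycle36 _ = 0"

text \<open>The value records where the minimum of the three values sits: 0, 2, 1 for i, i+1, i+2.
  The rotation s_i s_{i+1} raises it by 1 modulo 3, as c^{3,6} requires; s_{i+1} exchanges 1 and 2
  and fixes 0, so s_{i+1} + 1 gives 0 modulo 3, as c^{3,5} requires.\<close>

fun cochain36 :: "(nat \<Rightarrow> nat) \<times> 'x cell \<Rightarrow> int" where
  "cochain36 (\<sigma>, Gb i) =
     (if \<sigma> (i + 1) < \<sigma> i \<and> \<sigma> (i + 1) < \<sigma> (i + 2) then 2
      else if \<sigma> (i + 2) < \<sigma> i \<and> \<sigma> (i + 2) < \<sigma> (i + 1) then 1 else 0)"
| "cochain36 _ = 0"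

text \<open>
  In \<open>cochain37\<close> the summand with \<open>below\<close> serves to make the sum over the six \<open>d\<^bsub>i,i+2\<^esub>\<close>-terms of
  \<open>\<partial> c\<^bsup>3,7\<^esup>\<^sub>i\<close> odd; in \<open>cochain33\<close> it makes \<open>cocycle33\<close> even on \<open>c\<^bsup>3,7\<^esup>\<^sub>1 + c\<^bsup>3,2\<^esup>\<^sub>1\<^sub>3\<close>.
\<close>

definition below :: "(nat \<Rightarrow> nat) \<Rightarrow> nat \<Rightarrow> nat \<Rightarrow> bool" where
  "below \<sigma> i j \<longleftrightarrow> \<sigma> i < \<sigma> j \<and> \<sigma> i < \<sigma> (j + 1) \<and> \<sigma> (i + 1) < \<sigma> j \<and> \<sigma> (i + 1) < \<sigma> (j + 1)"

fun cocycle37 :: "'x cell \<Rightarrow> int" where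
  "cocycle37 (G32 i j) = (if i < j then 2 else 0)" | "cocycle37 (G37 i) = - 1" | "cocycle37 _ = 0"

fun cochain37 :: "(nat \<Rightarrow> nat) \<times> 'x cell \<Rightarrow> int" where
  "cochain37 (\<sigma>, Gd i j) = (if \<sigma> i < \<sigma> (i + 1) then 0 else 2)
     + (if below \<sigma> i j then (if \<sigma> i < \<sigma> (i + 1) \<longleftrightarrow> \<sigma> j < \<sigma> (j + 1) then - 1 else 1) else 0)"
| "cochain37 _ = 0"

fun cocycle33 :: "'x cell \<Rightarrow> int" where
  "cocycle33 (G32 i j) = 1" | "cocycle33 (G33 i j k) = 1" | "cocycle33 (G37 i) = 1" | "cocycle33 _ = 0"

fun cochain33 :: "(nat \<Rightarrow> nat) \<times> 'x cell \<Rightarrow> int" where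
  "cochain33 (\<sigma>, Gd i j) = of_bool (evenperm \<sigma>) + of_bool (below \<sigma> i j)"
| "cochain33 _ = 0"

lemma P_basis_3_cases:
  assumes "c \<in> P_basis n 3"
  obtains (31) i where "c = G31 i"
  | (32) i j where "c = G32 i j" "i + 2 \<le> j \<or> j + 2 \<le> i"
  | (33) i j k where "c = G33 i j k" "i + 2 \<le> j" "j + 2 \<le> k"
  | (34) i j where "c = G34 i j" "i + 2 < j \<or> j + 1 < i"
  | (35) i where "c = G35 i"
  | (36) i where "c = G36 i"
  | (37) i where "c = G37 i"
proof (cases c)
  case (G32 i j)
  with assms show ?thesis by (intro 32) (auto simp: P_basis_3_iff)
next
  case (G33 i j k)
  with assms show ?thesis by (intro 33) (auto simp: P_basis_3_iff)
next
  case (G34 i j)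
  with assms show ?thesis by (intro 34) (auto simp: P_basis_3_iff)
qed (use assms in \<open>simp_all add: P_basis_3_iff 31 35 36 37\<close>)

lemma permutes_neq: "\<sigma> permutes S \<Longrightarrow> i \<noteq> j \<Longrightarrow> \<sigma> i \<noteq> \<sigma> j"
  by (simp add: inj_eq[OF permutes_inj])

lemma cochain31_bd:
  assumes s: "\<sigma> permutes {1..n}" and c: "c \<in> P_basis n 3"
  shows "2 dvd evl cochain31 (sact \<sigma> (P_bd n c)) - cocycle31 c"
  using c
proof (cases rule: P_basis_3_cases)
  case (31 i)
  then show ?thesis using permutes_neq[OF s, of i "Suc i"]
    by (auto simp: P_bd_unfold evl_simps transpose_def)
next
  case (36 i)
  show ?thesis using permutes_neq[OF s, of i "Suc i"] permutes_neq[OF s, of i "Suc (Suc i)"] permutes_neq[OF s, of "Suc i" "Suc (Suc i)"]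
    by (auto simp: 36 P_bd_unfold evl_simps transpose_def)
qed (auto simp: P_bd_unfold evl_simps transpose_def)

text \<open>With ties excluded, \<open>neqE\<close> splits a goal into the strict orders of the
  values involved, and in each of them the order-dependent conditions are decided.\<close>

lemma permutes_neq4:
  assumes "\<sigma> permutes S"
  shows "\<sigma> i \<noteq> \<sigma> (Suc i)" "\<sigma> i \<noteq> \<sigma> (Suc (Suc i))" "\<sigma> i \<noteq> \<sigma> (Suc (Suc (Suc i)))"
    "\<sigma> (Suc i) \<noteq> \<sigma> (Suc (Suc i))" "\<sigma> (Suc i) \<noteq> \<sigma> (Suc (Suc (Suc i)))"
    "\<sigma> (Suc (Suc i)) \<noteq> \<sigma> (Suc (Suc (Suc i)))"
  by (simp_all add: permutes_neq[OF assms])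

lemma cochain36_bd:
  assumes s: "\<sigma> permutes {1..n}" and c: "c \<in> P_basis n 3"
  shows "3 dvd evl cochain36 (sact \<sigma> (P_bd n c)) - cocycle36 c"
  using c
proof (cases rule: P_basis_3_cases)
  case (34 i j)
  show ?thesis
    unfolding 34(1) using 34(2) by (elim disjE)
      (simp_all add: P_bd_unfold evl_simps transpose_apply_other cong: if_cong split del: if_split)
next
  case (35 i)
  show ?thesis
    unfolding 35 using permutes_neq4[OF s, of i]
    by (simp add: P_bd_unfold evl_simps transpose_apply_other split del: if_split) (elim neqE; simp)
next
  case (36 i)
  show ?thesis
    unfolding 36 using permutes_neq4[OF s, of i]
    by (simp add: P_bd_unfold evl_simps transpose_apply_other split del: if_split) (elim neqE; simp)
next
  case (37 i)
  show ?thesis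
    unfolding 37 using permutes_neq4[OF s, of i]
    by (simp add: P_bd_unfold evl_simps transpose_apply_other split del: if_split) (elim neqE; simp)
qed (auto simp: P_bd_unfold evl_simps)

text \<open>For i < j the boundary of c^{3,2}_ij contains -(s_i + 1) d_ij, where s_i reverses the
  first pair and the 2 occurs once. For j < i the second pair of d_ji is reversed, and the 2 occurs
  twice or never. Either way \<open>below\<close> is unchanged while its sign flips, so that summand
  cancels. The resulting values 2 and 0 match 2 c^{3,7}_i = c^{3,2}_{i+2,i} - c^{3,2}_{i,i+2} for an
  odd value on c^{3,7}_i.\<close>

lemma cochain37_bd:
  assumes s: "\<sigma> permutes {1..n}" and c: "c \<in> P_basis n 3"
  shows "4 dvd evl cochain37 (sact \<sigma> (P_bd n c)) - cocycle37 c"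
  using c
proof (cases rule: P_basis_3_cases)
  case (32 i j)
  show ?thesis
    unfolding 32(1) using 32(2)
  proof
    assume "i + 2 \<le> j"
    then show "4 dvd evl cochain37 (sact \<sigma> (P_bd n (G32 i j))) - cocycle37 (G32 i j)"
      using permutes_neq4(1)[OF s, of i] permutes_neq4(1)[OF s, of j]
      by (simp add: P_bd_unfold evl_simps transpose_apply_other below_def split del: if_split) (elim neqE; auto)
  next
    assume "j + 2 \<le> i"
    then show "4 dvd evl cochain37 (sact \<sigma> (P_bd n (G32 i j))) - cocycle37 (G32 i j)"
      using permutes_neq4(1)[OF s, of i] permutes_neq4(1)[OF s, of j]
      by (simp add: P_bd_unfold evl_simps transpose_apply_other below_def split del: if_split) (elim neqE; auto)
  qed
next
  case (33 i j k)
  then show ?thesis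
    by (simp add: P_bd_unfold evl_simps transpose_apply_other below_def cong: if_cong split del: if_split)
next
  \<comment> \<open>The words 1, s_i, s_{i+1} s_i carry (i+1, i+2) to the same ordered pairs as s_i
    s_{i+1}, s_{i+1}, 1 carry (i, i+1). Matched words have equal parity, so the two groups of d
    terms cancel.\<close>
  case (34 i j)
  show ?thesis
    unfolding 34(1) using 34(2) by (elim disjE)
      (simp_all add: P_bd_unfold evl_simps transpose_apply_other below_def cong: if_cong split del: if_split)
next
  \<comment> \<open>The six words carry {i, i+1} to each two-element subset of the four positions
    once, so \<open>below\<close> holds for exactly one d term. All other contributions are even,
    hence the sum is odd.\<close>
  case (37 i)
  show ?thesis
    unfolding 37 using permutes_neq4[OF s, of i]
    by (simp add: P_bd_unfold evl_simps transpose_apply_other below_def split del: if_split) (elim neqE; simp)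
qed (simp_all add: P_bd_unfold evl_simps)

lemma evenperm_transpose:
  "permutation \<sigma> \<Longrightarrow> evenperm (\<sigma> \<circ> transpose i (Suc i)) \<longleftrightarrow> \<not> evenperm \<sigma>"
  "permutation \<sigma> \<Longrightarrow> permutation (\<sigma> \<circ> transpose i (Suc i))"
  by (simp_all add: evenperm_comp permutation_swap_id evenperm_swap permutation_compose)

text \<open>An adjacent transposition changes the parity of \<sigma>: the three differences in the
  boundary of c^{3,3} are odd, and s_i + 1 in that of c^{3,2} meets one even permutation; the
  transpositions there leave \<open>below\<close> unchanged. Of the six words in c^{3,7} four are
  even and two odd, so only \<open>below\<close> contributes, once.\<close>

lemma cochain33_bd:
  assumes s: "\<sigma> permutes {1..n}" and c: "c \<in> P_basis n 3"
  shows "2 dvd evl cochain33 (sact \<sigma> (P_bd n c)) - cocycle33 c"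
proof -
  have perm: "permutation \<sigma>"
    using s permutation_permutes by blast
  from c show ?thesis
  proof (cases rule: P_basis_3_cases)
    case (32 i j)
    show ?thesis
      unfolding 32(1) using 32(2)
    proof
      assume "i + 2 \<le> j"
      with perm show "2 dvd evl cochain33 (sact \<sigma> (P_bd n (G32 i j))) - cocycle33 (G32 i j)"
        by (auto simp: P_bd_unfold evl_simps transpose_apply_other below_def evenperm_transpose)
    next
      assume "j + 2 \<le> i"
      with perm show "2 dvd evl cochain33 (sact \<sigma> (P_bd n (G32 i j))) - cocycle33 (G32 i j)"
        by (auto simp: P_bd_unfold evl_simps transpose_apply_other below_def evenperm_transpose)
    qed
  next
    case (33 i j k)
    with perm show ?thesis
      by (simp add: P_bd_unfold evl_simps transpose_apply_other below_def evenperm_transpose)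
  next
    case (34 i j)
    show ?thesis
      unfolding 34(1) using 34(2) perm by (elim disjE)
        (simp_all add: P_bd_unfold evl_simps transpose_apply_other below_def evenperm_transpose)
  next
    case (37 i)
    show ?thesis
      unfolding 37 using permutes_neq4[OF s, of i] perm
      by (simp add: P_bd_unfold evl_simps transpose_apply_other below_def evenperm_transpose) (elim neqE; simp)
  qed (simp_all add: P_bd_unfold evl_simps)
qed

text \<open>On the four classes the cocycles form an identity matrix modulo 2, 2, 3, 4. On the class
  of order 4, \<open>cocycle37\<close> is -1 + 2 = 1 and \<open>cocycle33\<close> is 1 + 1, which is
  even.\<close>

lemma comb_bounds_dvd:
  assumes "comb a b c d - comb a' b' c' d' \<in> bounds n"
  shows "2 dvd a - a'" "2 dvd b - b'" "3 dvd c - c'" "4 dvd d - d'"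
proof -
  have evl: "evl f (comb a b c d - comb a' b' c' d') = (a - a') * f (G31 1) + (b - b') * f (G33 1 3 5)
      + (c - c') * f (G36 1) + (d - d') * (f (G37 1) + f (G32 1 3))" for f :: "'a cell \<Rightarrow> int"
    by (simp add: comb_def evl_diff evl_add evl_cmul algebra_simps)
  show "2 dvd a - a'"
    using dvd_evl_bounds[OF cochain31_bd assms] by (simp add: evl)
  show "2 dvd b - b'"
    using dvd_evl_bounds[OF cochain33_bd assms] by (simp add: evl)
  show "3 dvd c - c'"
    using dvd_evl_bounds[OF cochain36_bd assms] by (simp add: evl)
  show "4 dvd d - d'"
    using dvd_evl_bounds[OF cochain37_bd assms] by (simp add: evl)
qed

section \<open>Coinvariants and homology\<close>

lemma subgroup_tot_zero: "subgroup {x \<in> carrier (fmod n S). tot x = 0} (fmod n S)"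
  by (rule group.subgroupI[OF group_fmod])
     (use fmod_add fmod_minus in \<open>auto simp: tot_add tot_minus simp del: fmod_simps(1)\<close>,
      auto intro!: exI[of _ 0])

lemma coinv_sub_eq: "coinv_sub (sym_group n) S = {x \<in> carrier (fmod n S). tot x = 0}"
proof
  let ?X = "{gact (sym_group n) g x - x | g x. g \<in> carrier (sym_group n) \<and> x \<in> carrier (fmod n S)}"
  have X: "coinv_sub (sym_group n) S = generate (fmod n S) ?X"
    by (simp add: coinv_sub_def fmod_def)
  have sub: "?X \<subseteq> carrier (fmod n S)"
  proof clarify
    fix g and x :: "'a schain"
    assume "g \<in> carrier (sym_group n)" "x \<in> carrier (fmod n S)"
    then show "gact (sym_group n) g x - x \<in> carrier (fmod n S)"
      unfolding gact_sym_group sym_group_carrier by (intro fmod_diff fmod_sact)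
  qed
  show "coinv_sub (sym_group n) S \<subseteq> {x \<in> carrier (fmod n S). tot x = 0}"
    unfolding X
  proof (rule group.generate_subgroup_incl[OF group_fmod _ subgroup_tot_zero])
    show "?X \<subseteq> {x \<in> carrier (fmod n S). tot x = 0}"
      using sub by (auto simp: gact_sym_group tot_diff tot_sact simp del: fmod_simps(1))
  qed
  have gen: "subgroup (generate (fmod n S) ?X) (fmod n S)"
    by (rule group.generate_is_subgroup[OF group_fmod sub])
  \<comment> \<open>Modulo the subgroup each \<sigma> c equals c, so x agrees with a lift that
    depends on \<open>tot x\<close> alone.\<close>
  have *: "x - frag_extend E (tot x) \<in> generate (fmod n S) ?X"
    if "Poly_Mapping.keys x \<subseteq> {p. p permutes {1..n}} \<times> S" for x
    using that
  proof (induction x rule: frag_induction)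
    case zero
    show ?case using subgroup.one_closed[OF gen] by simp
  next
    case (one y)
    then obtain p c where y: "y = (p, c)" "p permutes {1..n}" "c \<in> S" by auto
    then have "frag_of y - E c = gact (sym_group n) p (E c) - E c"
      by (simp add: gact_sym_group E_def sact_def)
    moreover have "E c \<in> carrier (fmod n S)"
      using y permutes_id by (simp add: E_def)
    ultimately have "frag_of y - E c \<in> ?X"
      using y by (auto simp: sym_group_carrier simp del: fmod_simps(1))
    then show ?case
      by (simp add: y tot_def generate.incl)
  next
    case (diff x y)
    have "- (y - frag_extend E (tot y)) \<in> generate (fmod n S) ?X"
      using subgroup.m_inv_closed[OF gen diff(2)] subgroup.mem_carrier[OF gen diff(2)] by (simp del: fmod_simps(1))
    from subgroup.m_closed[OF gen diff(1) this] show ?case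
      by (simp add: frag_extend_diff tot_diff algebra_simps)
  qed
  show "{x \<in> carrier (fmod n S). tot x = 0} \<subseteq> coinv_sub (sym_group n) S"
  proof
    fix x assume "x \<in> {x \<in> carrier (fmod n S). tot x = 0}"
    with *[of x] show "x \<in> coinv_sub (sym_group n) S"
      unfolding X by simp
  qed
qed

lemma subgroup_coinv_sub: "subgroup (coinv_sub (sym_group n) S) (fmod n S)"
  unfolding coinv_sub_eq by (rule subgroup_tot_zero)

lemma bar_eq:
  assumes "x \<in> carrier (fmod n S)"
  shows "bar (sym_group n) S x = {y \<in> carrier (fmod n S). tot y = tot x}"
proof -
  have "y \<in> bar (sym_group n) S x" if "y \<in> carrier (fmod n S)" "tot y = tot x" for y
  proof -
    have "y - x \<in> coinv_sub (sym_group n) S"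
      using that assms fmod_diff[of y n S x] by (simp add: coinv_sub_eq tot_diff)
    then show ?thesis
      by (force simp: bar_def r_coset_def simp flip: fmod_def)
  qed
  then show ?thesis
    using assms fmod_add
    by (auto simp: bar_def r_coset_def coinv_sub_eq tot_add simp flip: fmod_def simp del: fmod_simps(1))
qed

lemma bar_eq_iff:
  assumes "x \<in> carrier (fmod n S)" "y \<in> carrier (fmod n S)"
  shows "bar (sym_group n) S x = bar (sym_group n) S y \<longleftrightarrow> tot x = tot y"
  using assms by (auto simp: bar_eq simp del: fmod_simps(1))

lemma comm_group_coinv: "comm_group (coinv (sym_group n) (S :: 'x cell set))"
  using comm_group.abelian_FactGroup[OF comm_group_fmod subgroup_coinv_sub, of n S]
  by (simp add: coinv_def fmod_def)

lemma carrier_coinv: "carrier (coinv (sym_group n) S) = bar (sym_group n) S ` carrier (fmod n S)"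
  by (auto simp: coinv_def FactGroup_def RCOSETS_def bar_def fmod_def)

lemma mult_coinv:
  assumes "x \<in> carrier (fmod n S)" "y \<in> carrier (fmod n S)"
  shows "bar (sym_group n) S x \<otimes>\<^bsub>coinv (sym_group n) S\<^esub> bar (sym_group n) S y = bar (sym_group n) S (x + y)"
proof -
  have "coinv_sub (sym_group n) S \<lhd> fmod n S"
    by (rule comm_group.subgroup_imp_normal[OF comm_group_fmod subgroup_coinv_sub])
  from normal.rcos_sum[OF this assms] show ?thesis
    by (simp add: coinv_def bar_def flip: fmod_def)
qed

lemma one_coinv:
  fixes S :: "'x cell set"
  shows "\<one>\<^bsub>coinv (sym_group n) S\<^esub> = bar (sym_group n) S 0"
proof -
  have "\<one>\<^bsub>coinv (sym_group n) S\<^esub> = coinv_sub (sym_group n) S"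
    by (simp add: coinv_def)
  also have "\<dots> = bar (sym_group n) S 0"
    by (subst bar_eq) (simp_all add: coinv_sub_eq)
  finally show ?thesis .
qed

lemma tot_lin_ext: "tot (lin_ext (sym_group n) f x) = frag_extend (\<lambda>c. tot (f c)) (tot x)"
proof (induction x rule: frag_induction[OF subset_UNIV])
  case (2 x)
  obtain p c where "x = (p, c)" by (cases x)
  then show ?case
    by (simp add: lin_ext_def gact_sym_group tot_sact) (simp add: tot_def)
qed (simp_all add: lin_ext_def frag_extend_diff tot_diff)

lemma lin_ext_closed:
  assumes "\<forall>c\<in>S. f c \<in> carrier (fmod n S')" "x \<in> carrier (fmod n S)"
  shows "lin_ext (sym_group n) f x \<in> carrier (fmod n S')"
proof -
  have "Poly_Mapping.keys x \<subseteq> {p. p permutes {1..n}} \<times> S"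
    using assms by simp
  then show ?thesis
  proof (induction x rule: frag_induction)
    case (one x)
    then show ?case
      using assms(1) by (auto simp: lin_ext_def gact_sym_group intro!: fmod_sact simp del: fmod_simps(1) One_nat_def)
  next
    case (diff x y)
    then show ?case
      using fmod_diff by (simp add: lin_ext_def frag_extend_diff del: fmod_simps(1))
  qed (simp add: lin_ext_def)
qed

text \<open>By \<open>tot_lin_ext\<close> the image coset depends only on \<open>tot x\<close>, so
  \<open>the_elem\<close> is applied to a singleton.\<close>

lemma coinv_map_bar:
  assumes f: "\<forall>c\<in>S. f c \<in> carrier (fmod n S')" and x: "x \<in> carrier (fmod n S)"
  shows "coinv_map (sym_group n) S S' (lin_ext (sym_group n) f) (bar (sym_group n) S x)
    = bar (sym_group n) S' (lin_ext (sym_group n) f x)"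
proof -
  have eq: "bar (sym_group n) S' (lin_ext (sym_group n) f y) = bar (sym_group n) S' (lin_ext (sym_group n) f x)"
    if "y \<in> bar (sym_group n) S x" for y
  proof -
    have "y \<in> carrier (fmod n S)" "tot y = tot x"
      using that unfolding bar_eq[OF x] by blast+
    then show ?thesis
      by (simp only: bar_eq_iff lin_ext_closed[OF f] x tot_lin_ext)
  qed
  have "bar (sym_group n) S x \<noteq> {}"
    unfolding bar_eq[OF x] using x by blast
  then show ?thesis
    unfolding coinv_map_def by (rule the_elem_image_unique) (rule eq)
qed

lemma P_basis_2_iff:
  "Gc i \<in> P_basis n 2 \<longleftrightarrow> 1 \<le> i \<and> i < n"
  "Gb i \<in> P_basis n 2 \<longleftrightarrow> 1 \<le> i \<and> i + 1 < n"
  "Gd i j \<in> P_basis n 2 \<longleftrightarrow> 1 \<le> i \<and> i + 2 \<le> j \<and> j < n"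
  by (auto simp: P_basis_def)

lemma P_bd_closed:
  assumes "c \<in> P_basis n 3"
  shows "P_bd n c \<in> chain n 2"
proof (cases c)
  case (G31 i)
  with assms have "1 \<le> i \<and> i < n"
    by (auto simp: P_basis_3_iff)
  then show ?thesis
    unfolding G31
    by (simp add: P_bd_unfold T_lin, intro chain_intros; simp add: P_basis_2_iff)
next
  case (G32 i j)
  with assms have "1 \<le> i \<and> i < n \<and> 1 \<le> j \<and> j < n" and "i + 2 \<le> j \<or> j + 2 \<le> i"
    by (auto simp: P_basis_3_iff)
  then show ?thesis
    unfolding G32 by (cases "i < j")
      (simp add: P_bd_unfold T_lin, intro chain_intros; simp add: P_basis_2_iff)+
next
  case (G33 i j k)
  with assms have "1 \<le> i \<and> i + 2 \<le> j \<and> j + 2 \<le> k \<and> k < n"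
    by (auto simp: P_basis_3_iff)
  then show ?thesis
    unfolding G33
    by (simp add: P_bd_unfold T_lin, intro chain_intros; simp add: P_basis_2_iff)
next
  case (G34 i j)
  with assms have "1 \<le> i \<and> i + 1 < n \<and> 1 \<le> j \<and> j < n" and "i + 2 < j \<or> j + 1 < i"
    by (auto simp: P_basis_3_iff)
  then show ?thesis
    unfolding G34 by (cases "i + 2 < j")
      (simp add: P_bd_unfold T_lin, intro chain_intros; simp add: P_basis_2_iff)+
next
  case (G35 i)
  with assms have "1 \<le> i \<and> i + 1 < n"
    by (auto simp: P_basis_3_iff)
  then show ?thesis
    unfolding G35
    by (simp add: P_bd_unfold T_lin, intro chain_intros; simp add: P_basis_2_iff)
next
  case (G36 i)
  with assms have "1 \<le> i \<and> i + 1 < n"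
    by (auto simp: P_basis_3_iff)
  then show ?thesis
    unfolding G36
    by (simp add: P_bd_unfold T_lin, intro chain_intros; simp add: P_basis_2_iff)
next
  case (G37 i)
  with assms have "1 \<le> i \<and> i + 2 < n"
    by (auto simp: P_basis_3_iff)
  then show ?thesis
    unfolding G37
    by (simp add: P_bd_unfold T_lin, intro chain_intros; simp add: P_basis_2_iff)
qed (use assms in \<open>simp_all add: P_basis_3_iff\<close>)

text \<open>
  A description of the truncated homology that only depends on the bases and boundaries in
  dimensions 2 and 3.
\<close>

definition cycles :: "nat \<Rightarrow> 'x schain set" where
  "cycles n = {x \<in> chain n 3. dbar (tot x) = 0}"

definition barP :: "nat \<Rightarrow> 'x schain \<Rightarrow> 'x schain set" where
  "barP n = bar (sym_group n) (P_basis n 3)"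

definition coinvP :: "nat \<Rightarrow> 'x schain set monoid" where
  "coinvP n = coinv (sym_group n) (P_basis n 3)"

definition cycle_group :: "nat \<Rightarrow> 'x schain set monoid" where
  "cycle_group n = coinvP n\<lparr>carrier := barP n ` cycles n\<rparr>"

definition boundary_set :: "nat \<Rightarrow> 'x schain set set" where
  "boundary_set n = barP n ` {x \<in> chain n 3. bd n x = 0}"

definition H3 :: "nat \<Rightarrow> 'x schain set set monoid" where
  "H3 n = cycle_group n Mod boundary_set n"

definition cls :: "nat \<Rightarrow> 'x schain \<Rightarrow> 'x schain set set" where
  "cls n x = boundary_set n #>\<^bsub>cycle_group n\<^esub> barP n x"

lemma lin_ext_bd:
  assumes "\<forall>c\<in>P_basis n 3. d c = P_bd n c" "x \<in> chain n 3"
  shows "lin_ext (sym_group n) d x = bd n x"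
  unfolding bd_def lin_ext_def
  by (rule frag_extend_eq) (use assms in \<open>auto simp: chain_iff\<close>)

text \<open>Stated for any bases and boundaries that agree with P_* in dimensions 2 and 3, to serve
  both the truncated complex and every completion.\<close>

lemma coinv_cycles_3:
  fixes S :: "nat \<Rightarrow> 'x cell set"
  assumes S: "S 3 = P_basis n 3" "S 2 = P_basis n 2" and d: "\<forall>c\<in>P_basis n 3. d 3 c = P_bd n c"
  shows "coinv_cycles (sym_group n) S d 3 = barP n ` cycles n"
proof -
  have closed: "\<forall>c\<in>P_basis n 3. d 3 c \<in> carrier (fmod n (P_basis n 2))"
    using d P_bd_closed unfolding chain_def by metis
  have *: "coinv_map (sym_group n) (P_basis n 3) (P_basis n 2) (lin_ext (sym_group n) (d 3)) (barP n x)
      = \<one>\<^bsub>coinv (sym_group n) (P_basis n 2)\<^esub> \<longleftrightarrow> dbar (tot x) = 0" if x: "x \<in> chain n 3" for x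
  proof -
    have "bd n x \<in> carrier (fmod n (P_basis n 2))"
      using lin_ext_closed[OF closed, of x] x unfolding lin_ext_bd[OF d x] chain_def .
    moreover have "0 \<in> carrier (fmod n (P_basis n 2))"
      by simp
    ultimately have "bar (sym_group n) (P_basis n 2) (bd n x) = bar (sym_group n) (P_basis n 2) 0
        \<longleftrightarrow> tot (bd n x) = tot 0"
      by (rule bar_eq_iff)
    moreover have "coinv_map (sym_group n) (P_basis n 3) (P_basis n 2) (lin_ext (sym_group n) (d 3)) (barP n x)
        = bar (sym_group n) (P_basis n 2) (bd n x)"
      unfolding barP_def using coinv_map_bar[OF closed x[unfolded chain_def]] lin_ext_bd[OF d x] by simp
    ultimately show ?thesis
      by (simp only: one_coinv tot_0 tot_bd)
  qed
  have "coinv_cycles (sym_group n) S d 3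
      = {Y \<in> barP n ` chain n 3. coinv_map (sym_group n) (P_basis n 3) (P_basis n 2) (lin_ext (sym_group n) (d 3)) Y
          = \<one>\<^bsub>coinv (sym_group n) (P_basis n 2)\<^esub>}"
    by (simp add: coinv_cycles_def S kernel_def carrier_coinv barP_def chain_def)
  also have "\<dots> = barP n ` cycles n"
    using * unfolding cycles_def by blast
  finally show ?thesis .
qed

lemma trunc_boundaries_3: "trunc_boundaries (sym_group n) (P_basis n) (\<lambda>_. P_bd n) 3 = boundary_set n"
  by (simp add: trunc_boundaries_def boundary_set_def kernel_def barP_def chain_def fmod_def bd_def free_mod_def)

lemma trunc_homology_3: "trunc_homology (sym_group n) (P_basis n) (\<lambda>_. P_bd n) 3 = H3 n"
  unfolding trunc_homology_def H3_def coinv_cycle_group_def cycle_group_def coinvP_def trunc_boundaries_3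
  by (subst coinv_cycles_3) simp_all

lemma trunc_class_3: "trunc_class (sym_group n) (P_basis n) (\<lambda>_. P_bd n) 3 = cls n"
  unfolding trunc_class_def cls_def coinv_cycle_group_def cycle_group_def coinvP_def barP_def trunc_boundaries_3
  by (subst coinv_cycles_3) (simp_all add: barP_def)

text \<open>Exactness turns the image of the fourth boundary map into ker \<partial>_3. Cycles and
  boundaries are then the same sets as for the truncation, and the quotient groups are equal, not
  merely isomorphic.\<close>

lemma completion:
  fixes S :: "nat \<Rightarrow> 'x cell set"
  assumes "completes_P n S d \<epsilon>"
  shows "group_homology (sym_group n) S d 3 = H3 n"
    and "homology_class (sym_group n) S d 3 x = cls n x"
proof -
  have res: "free_resolution (sym_group n) S d \<epsilon>"
    and basis: "\<forall>k\<le>3. S k = P_basis n k"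
    and bds: "\<forall>k\<in>{1..3}. \<forall>b\<in>P_basis n k. d k b = P_bd n b"
    using assms unfolding completes_P_def by blast+
  have S: "S 3 = P_basis n 3" "S 2 = P_basis n 2"
    using spec[OF basis, of 3] spec[OF basis, of 2] by simp_all
  have d: "\<forall>c\<in>P_basis n 3. d 3 c = P_bd n c"
    using bspec[OF bds, of 3] by simp
  have nat: "Suc 2 = 3" "Suc 3 = 4"
    by simp_all
  have closed: "\<forall>c\<in>S 4. d 4 c \<in> carrier (fmod n (P_basis n 3))"
  proof -
    have "\<forall>k. \<forall>b\<in>S (Suc k). d (Suc k) b \<in> carrier (free_mod (sym_group n) (S k))"
      using res unfolding free_resolution_def by (elim conjE)
    from spec[OF this, of 3] show ?thesis unfolding nat S fmod_def .
  qed
  have exact: "kernel (fmod n (P_basis n 3)) (fmod n (P_basis n 2)) (lin_ext (sym_group n) (d 3))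
      = lin_ext (sym_group n) (d 4) ` carrier (fmod n (S 4))"
  proof -
    have "\<forall>k. kernel (free_mod (sym_group n) (S (Suc k))) (free_mod (sym_group n) (S k)) (lin_ext (sym_group n) (d (Suc k)))
      = lin_ext (sym_group n) (d (Suc (Suc k))) ` carrier (free_mod (sym_group n) (S (Suc (Suc k))))"
      using res unfolding free_resolution_def by (elim conjE)
    \<comment> \<open>The exactness clause is indexed by the target of the map: k = 2 speaks of the
      kernel of \<open>d 3\<close>.\<close>
    from spec[OF this, of 2] show ?thesis unfolding nat S fmod_def .
  qed
  have "coinv_boundaries (sym_group n) S d 3
      = (\<lambda>x. barP n (lin_ext (sym_group n) (d 4) x)) ` carrier (fmod n (S 4))"
    unfolding coinv_boundaries_def nat S carrier_coinv image_image barP_def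
    by (rule image_cong) (rule refl, rule coinv_map_bar[OF closed])
  also have "\<dots> = barP n ` kernel (fmod n (P_basis n 3)) (fmod n (P_basis n 2)) (lin_ext (sym_group n) (d 3))"
    unfolding exact by (simp only: image_image)
  also have "\<dots> = boundary_set n"
    unfolding boundary_set_def kernel_def chain_def
    by (simp only: lin_ext_bd[OF d, unfolded chain_def] fmod_simps(3) cong: conj_cong)
  finally have bd: "coinv_boundaries (sym_group n) S d 3 = boundary_set n" .
  show "group_homology (sym_group n) S d 3 = H3 n"
    unfolding group_homology_def coinv_cycle_group_def bd coinv_cycles_3[where S = S and d = d, OF S d] S
    by (simp only: H3_def cycle_group_def coinvP_def)
  show "homology_class (sym_group n) S d 3 x = cls n x"
    unfolding homology_class_def coinv_cycle_group_def bd coinv_cycles_3[where S = S and d = d, OF S d] S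
    by (simp only: cls_def cycle_group_def coinvP_def barP_def)
qed

lemma bd_0_cycles: "x \<in> chain n 3 \<Longrightarrow> bd n x = 0 \<Longrightarrow> x \<in> cycles n"
  by (simp add: cycles_def flip: tot_bd[of n])

lemma cycles_chain: "x \<in> cycles n \<Longrightarrow> x \<in> chain n 3"
  by (simp add: cycles_def)

lemma cycles_0: "0 \<in> cycles n"
  by (simp add: cycles_def chain_0)

lemma cycles_add: "x \<in> cycles n \<Longrightarrow> y \<in> cycles n \<Longrightarrow> x + y \<in> cycles n"
  by (simp add: cycles_def chain_add tot_add dbar_add)

lemma cycles_minus: "x \<in> cycles n \<Longrightarrow> - x \<in> cycles n"
  using dbar_diff[of 0 "tot x"] by (simp add: cycles_def chain_minus tot_minus)

lemma comm_group_coinvP: "comm_group (coinvP n)"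
  unfolding coinvP_def by (rule comm_group_coinv)

lemma group_coinvP: "group (coinvP n)"
  by (rule comm_group.axioms(2)[OF comm_group_coinvP])

lemma barP_closed: "x \<in> chain n 3 \<Longrightarrow> barP n x \<in> carrier (coinvP n)"
  unfolding coinvP_def carrier_coinv barP_def chain_def by (rule imageI)

lemma barP_mult: "x \<in> chain n 3 \<Longrightarrow> y \<in> chain n 3 \<Longrightarrow> barP n x \<otimes>\<^bsub>coinvP n\<^esub> barP n y = barP n (x + y)"
  unfolding coinvP_def barP_def chain_def by (rule mult_coinv)

lemma barP_one: "\<one>\<^bsub>coinvP n\<^esub> = barP n 0"
  unfolding coinvP_def barP_def by (rule one_coinv)

lemma barP_inv:
  assumes "x \<in> chain n 3"
  shows "inv\<^bsub>coinvP n\<^esub> barP n x = barP n (- x)"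
  by (rule group.inv_equality[OF group_coinvP])
     (simp_all add: barP_closed barP_mult barP_one chain_minus assms)

lemma barP_eq_iff: "x \<in> chain n 3 \<Longrightarrow> y \<in> chain n 3 \<Longrightarrow> barP n x = barP n y \<longleftrightarrow> tot x = tot y"
  unfolding barP_def chain_def by (rule bar_eq_iff)

lemma subgroup_barP:
  assumes "A \<subseteq> chain n 3" "0 \<in> A" "\<And>x. x \<in> A \<Longrightarrow> - x \<in> A" "\<And>x y. x \<in> A \<Longrightarrow> y \<in> A \<Longrightarrow> x + y \<in> A"
  shows "subgroup (barP n ` A) (coinvP n)"
proof (rule group.subgroupI[OF group_coinvP])
  show "barP n ` A \<subseteq> carrier (coinvP n)"
    using assms(1) barP_closed by blast
  show "barP n ` A \<noteq> {}"
    using assms(2) by blast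
  show "inv\<^bsub>coinvP n\<^esub> Y \<in> barP n ` A" if Y: "Y \<in> barP n ` A" for Y
  proof -
    obtain x where "x \<in> A" "Y = barP n x" using Y by blast
    then show ?thesis
      using assms(1,3) barP_inv[of x n] by (simp add: subset_iff)
  qed
  show "Y \<otimes>\<^bsub>coinvP n\<^esub> Y' \<in> barP n ` A" if Y: "Y \<in> barP n ` A" "Y' \<in> barP n ` A" for Y Y'
  proof -
    obtain x y where "x \<in> A" "y \<in> A" "Y = barP n x" "Y' = barP n y" using Y by blast
    then show ?thesis
      using assms(1,4) barP_mult[of x n y] by (simp add: subset_iff)
  qed
qed

lemma subgroup_cycles: "subgroup (barP n ` cycles n) (coinvP n)"
  by (rule subgroup_barP) (auto intro: cycles_chain cycles_0 cycles_minus cycles_add)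

lemma comm_group_cycle_group: "comm_group (cycle_group n)"
proof (rule group.group_comm_groupI)
  show "group (cycle_group n)"
    unfolding cycle_group_def by (rule group.subgroup_imp_group[OF group_coinvP subgroup_cycles])
  show "Y \<otimes>\<^bsub>cycle_group n\<^esub> Y' = Y' \<otimes>\<^bsub>cycle_group n\<^esub> Y"
    if "Y \<in> carrier (cycle_group n)" "Y' \<in> carrier (cycle_group n)" for Y Y'
    using that by (auto simp: cycle_group_def barP_mult cycles_chain add.commute)
qed

lemma subgroup_boundary_set: "subgroup (boundary_set n) (cycle_group n)"
  unfolding cycle_group_def
proof (rule group.subgroup_incl[OF group_coinvP _ subgroup_cycles])
  show "subgroup (boundary_set n) (coinvP n)"
    unfolding boundary_set_def
    by (rule subgroup_barP) (auto intro: chain_0 chain_minus chain_add simp: bd_minus bd_add)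
  show "boundary_set n \<subseteq> barP n ` cycles n"
    unfolding boundary_set_def using bd_0_cycles by blast
qed

lemma comm_group_H3: "comm_group (H3 n)"
  unfolding H3_def by (rule comm_group.abelian_FactGroup[OF comm_group_cycle_group subgroup_boundary_set])

lemma carrier_H3: "carrier (H3 n) = cls n ` cycles n"
  by (auto simp: H3_def FactGroup_def RCOSETS_def cls_def cycle_group_def)

lemma one_H3: "\<one>\<^bsub>H3 n\<^esub> = (cls n 0 :: 'x schain set set)"
proof -
  have "boundary_set n #>\<^bsub>cycle_group n\<^esub> \<one>\<^bsub>cycle_group n\<^esub> = (boundary_set n :: 'x schain set set)"
    by (rule group.coset_mult_one[OF comm_group.axioms(2)[OF comm_group_cycle_group]
          subgroup.subset[OF subgroup_boundary_set]])
  then show ?thesis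
    by (simp add: H3_def cls_def cycle_group_def barP_one)
qed

lemma mult_H3:
  assumes "x \<in> cycles n" "y \<in> cycles n"
  shows "cls n x \<otimes>\<^bsub>H3 n\<^esub> cls n y = cls n (x + y)"
proof -
  have "boundary_set n \<lhd> cycle_group n"
    by (rule comm_group.subgroup_imp_normal[OF comm_group_cycle_group subgroup_boundary_set])
  moreover have "barP n x \<in> carrier (cycle_group n)" "barP n y \<in> carrier (cycle_group n)"
    using assms by (simp_all add: cycle_group_def)
  ultimately have "cls n x \<otimes>\<^bsub>H3 n\<^esub> cls n y = boundary_set n #>\<^bsub>cycle_group n\<^esub> (barP n x \<otimes>\<^bsub>cycle_group n\<^esub> barP n y)"
    unfolding cls_def H3_def mult_FactGroup by (rule normal.rcos_sum)
  also have "barP n x \<otimes>\<^bsub>cycle_group n\<^esub> barP n y = barP n (x + y)"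
    using assms by (simp add: cycle_group_def barP_mult cycles_chain)
  finally show ?thesis
    by (simp add: cls_def)
qed

lemma cls_eq_iff:
  assumes "x \<in> cycles n" "y \<in> cycles n"
  shows "cls n x = cls n y \<longleftrightarrow> eqv n (tot x) (tot y)"
proof -
  have grp: "group (cycle_group n)"
    by (rule comm_group.axioms(2)[OF comm_group_cycle_group])
  have car: "barP n x \<in> carrier (cycle_group n)" "barP n y \<in> carrier (cycle_group n)"
    using assms by (simp_all add: cycle_group_def)
  have "cls n x = cls n y \<longleftrightarrow> barP n x \<in> cls n y"
    unfolding cls_def
    using group.repr_independence[OF grp _ car(2) subgroup_boundary_set, of "barP n x"]
      group.rcos_self[OF grp car(1) subgroup_boundary_set] by metis
  also have "\<dots> \<longleftrightarrow> (\<exists>z\<in>chain n 3. bd n z = 0 \<and> barP n x = barP n (z + y))"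
    unfolding cls_def r_coset_def boundary_set_def
    using barP_mult[OF _ cycles_chain[OF assms(2)]] by (auto simp: cycle_group_def)
  also have "\<dots> \<longleftrightarrow> (\<exists>z\<in>chain n 3. bd n z = 0 \<and> tot x - tot y = tot z)"
    by (intro bex_cong refl conj_cong)
       (auto simp: barP_eq_iff cycles_chain[OF assms(1)] cycles_chain[OF assms(2)] chain_add tot_add algebra_simps)
  also have "\<dots> \<longleftrightarrow> eqv n (tot x) (tot y)"
    unfolding eqv_def bounds_def by blast
  finally show ?thesis .
qed

section \<open>The group structure in terms of the four classes\<close>

definition lift :: "int \<Rightarrow> int \<Rightarrow> int \<Rightarrow> int \<Rightarrow> 'x schain" where
  "lift a b c d = frag_cmul a (E (G31 1)) + frag_cmul b (E (G33 1 3 5)) + frag_cmul c (E (G36 1))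
     + frag_cmul d (E (G37 1) + E (G32 1 3))"

lemma tot_lift: "tot (lift a b c d :: 'x schain) = comb a b c d"
proof -
  have "tot (frag_cmul k x) = frag_cmul k (tot x)" for k and x :: "'x schain"
    by (simp add: tot_def frag_extend_cmul)
  then show ?thesis
    by (simp add: lift_def comb_def tot_add tot_E)
qed

lemma lift_add: "lift a b c d + lift a' b' c' d' = lift (a + a') (b + b') (c + c') (d + d')"
  by (simp add: lift_def frag_cmul_distrib algebra_simps)

lemma lift_cycles:
  assumes "n \<ge> 6"
  shows "(lift a b c d :: 'x schain) \<in> cycles n"
proof -
  have cmul: "frag_cmul k x \<in> chain n 3" if "x \<in> chain n 3" for k and x :: "'x schain"
    using that keys_cmul[of k x] by (auto simp: chain_iff)
  have "(lift a b c d :: 'x schain) \<in> chain n 3"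
    unfolding lift_def using assms by (intro chain_add cmul chain_E) (auto simp: P_basis_3_iff)
  then show ?thesis
    by (simp add: cycles_def tot_lift)
qed

text \<open>Here the two bounds meet: \<open>comb_cong\<close> identifies classes and
  \<open>comb_bounds_dvd\<close> separates them. What follows is arithmetic with four
  residues.\<close>

lemma cls_lift_eq_iff:
  assumes "n \<ge> 6"
  shows "cls n (lift a b c d) = cls n (lift a' b' c' d')
    \<longleftrightarrow> 2 dvd a - a' \<and> 2 dvd b - b' \<and> 3 dvd c - c' \<and> 4 dvd d - d'"
  using comb_cong[OF assms, of a a' b b' c c' d d'] comb_bounds_dvd[of a b c d a' b' c' d' n]
  by (auto simp: cls_eq_iff lift_cycles[OF assms] tot_lift eqv_def)

lemma carrier_H3_lift:
  assumes "n \<ge> 6" "Y \<in> carrier (H3 n)"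
  obtains a b c d where "Y = cls n (lift a b c d)"
proof -
  obtain x where x: "x \<in> cycles n" "Y = cls n x"
    using assms(2) unfolding carrier_H3 by blast
  have "Poly_Mapping.keys (tot x) \<subseteq> P_basis n 3"
    using x(1) keys_frag_extend[of "\<lambda>(g, c). frag_of c" x]
    by (fastforce simp: cycles_def chain_iff tot_def split: prod.splits)
  moreover have "dbar (tot x) = 0"
    using x(1) by (simp add: cycles_def)
  ultimately obtain a b c d where "eqv n (tot x) (comb a b c d)"
    using eqv_comb by blast
  then have "Y = cls n (lift a b c d)"
    unfolding x(2) by (simp add: cls_eq_iff x(1) lift_cycles[OF assms(1)] tot_lift)
  then show thesis by (rule that)
qed

lemma pow_cls_lift:
  assumes "n \<ge> 6"
  shows "cls n (lift a b c d) [^]\<^bsub>H3 n\<^esub> (m :: nat) = cls n (lift (m * a) (m * b) (m * c) (m * d))"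
proof (induction m)
  case 0
  show ?case by (simp add: one_H3 lift_def)
next
  case (Suc m)
  then show ?case
    by (simp add: mult_H3 lift_cycles[OF assms] lift_add algebra_simps)
qed

lemma ord_cls_lift:
  assumes "n \<ge> 6" and "\<And>m :: nat. 2 dvd m * a \<and> 2 dvd m * b \<and> 3 dvd m * c \<and> 4 dvd m * d \<longleftrightarrow> int k dvd m"
  shows "group.ord (H3 n) (cls n (lift a b c d :: 'x schain)) = k"
proof -
  have grp: "group (H3 n :: 'x schain set set monoid)"
    by (rule comm_group.axioms(2)[OF comm_group_H3])
  have closed: "cls n (lift a b c d :: 'x schain) \<in> carrier (H3 n)"
    unfolding carrier_H3 using lift_cycles[OF assms(1)] by blast
  have "group.ord (H3 n) (cls n (lift a b c d :: 'x schain)) dvd m \<longleftrightarrow> k dvd m" for m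
  proof -
    have "cls n (lift a b c d :: 'x schain) [^]\<^bsub>H3 n\<^esub> m = \<one>\<^bsub>H3 n\<^esub> \<longleftrightarrow> k dvd m"
    proof -
      have "\<one>\<^bsub>H3 n\<^esub> = cls n (lift 0 0 0 0 :: 'x schain)"
        by (simp add: one_H3 lift_def)
      then show ?thesis
        using assms(2)[of m] by (simp add: pow_cls_lift[OF assms(1)] cls_lift_eq_iff[OF assms(1)])
    qed
    then show ?thesis
      using group.pow_eq_id[OF grp closed] by simp
  qed
  then show ?thesis
    by (meson dvd_antisym dvd_refl)
qed

lemma generate_H3:
  assumes "n \<ge> 6"
  shows "carrier (H3 n :: 'x schain set set monoid) = generate (H3 n)
    {cls n (lift 1 0 0 0), cls n (lift 0 1 0 0), cls n (lift 0 0 1 0), cls n (lift 0 0 0 1)}"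
    (is "_ = generate _ ?X")
proof
  have grp: "group (H3 n :: 'x schain set set monoid)"
    by (rule comm_group.axioms(2)[OF comm_group_H3])
  have X: "?X \<subseteq> carrier (H3 n)"
    unfolding carrier_H3 using lift_cycles[OF assms] by blast
  show "generate (H3 n) ?X \<subseteq> carrier (H3 n)"
    by (rule group.generate_incl[OF grp X])
  show "carrier (H3 n) \<subseteq> generate (H3 n) ?X"
  proof
    fix Y :: "'x schain set set"
    assume Y: "Y \<in> carrier (H3 n)"
    then obtain a b c d where abcd: "Y = cls n (lift a b c d)"
      by (rule carrier_H3_lift[OF assms])
    have pow: "x [^]\<^bsub>H3 n\<^esub> (m :: nat) \<in> generate (H3 n) ?X" if x: "x \<in> ?X" for x m
    proof (induction m)
      case 0
      show ?case by (simp add: generate.one)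
    next
      case (Suc m)
      then show ?case using generate.eng[OF Suc generate.incl[OF x]] by simp
    qed
    \<comment> \<open>Reducing the coefficients makes them natural numbers, so that powers with
      natural exponents suffice.\<close>
    define a' b' c' d' where "a' = nat (a mod 2)" "b' = nat (b mod 2)" "c' = nat (c mod 3)" "d' = nat (d mod 4)"
    have "Y = cls n (lift a' b' c' d')"
      unfolding abcd cls_lift_eq_iff[OF assms] a'_b'_c'_d'_def
      by (simp add: mod_eq_dvd_iff[symmetric])
    also have "\<dots> = cls n (lift 1 0 0 0) [^]\<^bsub>H3 n\<^esub> a' \<otimes>\<^bsub>H3 n\<^esub> cls n (lift 0 1 0 0) [^]\<^bsub>H3 n\<^esub> b'
        \<otimes>\<^bsub>H3 n\<^esub> cls n (lift 0 0 1 0) [^]\<^bsub>H3 n\<^esub> c' \<otimes>\<^bsub>H3 n\<^esub> cls n (lift 0 0 0 1) [^]\<^bsub>H3 n\<^esub> d'"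
      by (simp add: pow_cls_lift[OF assms] mult_H3 lift_cycles[OF assms] lift_add)
    also have "\<dots> \<in> generate (H3 n) ?X"
      by (intro generate.eng pow) auto
    finally show "Y \<in> generate (H3 n) ?X" .
  qed
qed

lemma H3_iso:
  assumes "n \<ge> 6"
  shows "(H3 n :: 'x schain set set monoid) \<cong> (integer_mod_group 2 \<times>\<times> integer_mod_group 2) \<times>\<times> integer_mod_group 3 \<times>\<times> integer_mod_group 4"
    (is "_ \<cong> ?K")
proof -
  define \<psi> :: "(int \<times> int) \<times> int \<times> int \<Rightarrow> 'x schain set set"
    where "\<psi> = (\<lambda>((a, b), c, d). cls n (lift a b c d))"
  have grp: "group ?K"
    by (intro DirProd_group group_integer_mod_group)
  have car: "carrier ?K = ({0..<2} \<times> {0..<2}) \<times> {0..<3} \<times> {0..<4}"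
    by (simp add: carrier_integer_mod_group)
  have "\<psi> \<in> hom ?K (H3 n)"
  proof (rule homI)
    fix s assume "s \<in> carrier ?K"
    then show "\<psi> s \<in> carrier (H3 n)"
      by (auto simp: \<psi>_def carrier_H3 intro!: imageI lift_cycles[OF assms])
  next
    fix s t assume "s \<in> carrier ?K" "t \<in> carrier ?K"
    obtain a b c d where s: "s = ((a, b), c, d)" by (cases s) auto
    obtain a' b' c' d' where t: "t = ((a', b'), c', d')" by (cases t) auto
    \<comment> \<open>The components are added modulo 2, 2, 3, 4 on the left and as integers in
      \<open>lift_add\<close>; \<open>cls_lift_eq_iff\<close> absorbs the difference.\<close>
    show "\<psi> (s \<otimes>\<^bsub>?K\<^esub> t) = \<psi> s \<otimes>\<^bsub>H3 n\<^esub> \<psi> t"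
      by (simp add: s t \<psi>_def mult_H3 lift_cycles[OF assms] lift_add cls_lift_eq_iff[OF assms] flip: mod_eq_dvd_iff)
  qed
  moreover have "bij_betw \<psi> (carrier ?K) (carrier (H3 n))"
    unfolding bij_betw_def
  proof
    show "inj_on \<psi> (carrier ?K)"
      unfolding car
    proof (rule inj_onI)
      fix s t :: "(int \<times> int) \<times> int \<times> int"
      assume st: "s \<in> ({0..<2} \<times> {0..<2}) \<times> {0..<3} \<times> {0..<4}" "t \<in> ({0..<2} \<times> {0..<2}) \<times> {0..<3} \<times> {0..<4}" "\<psi> s = \<psi> t"
      have *: "x = y" if "m dvd x - y" "x \<in> {0..<m}" "y \<in> {0..<m}" for m x y :: int
        using that by (metis atLeastLessThan_iff mod_eq_dvd_iff mod_pos_pos_trivial)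
      obtain a b c d where s: "s = ((a, b), c, d)" by (cases s) auto
      obtain a' b' c' d' where t: "t = ((a', b'), c', d')" by (cases t) auto
      show "s = t"
        using st *[of 2 a a'] *[of 2 b b'] *[of 3 c c'] *[of 4 d d']
        by (simp add: s t \<psi>_def cls_lift_eq_iff[OF assms])
    qed
    show "\<psi> ` carrier ?K = carrier (H3 n)"
    proof
      show "\<psi> ` carrier ?K \<subseteq> carrier (H3 n)"
        by (auto simp: \<psi>_def carrier_H3 intro!: imageI lift_cycles[OF assms])
      show "carrier (H3 n) \<subseteq> \<psi> ` carrier ?K"
      proof
        fix Y :: "'x schain set set"
        assume "Y \<in> carrier (H3 n)"
        then obtain a b c d where "Y = cls n (lift a b c d)"
          by (rule carrier_H3_lift[OF assms])
        then have "Y = \<psi> ((a mod 2, b mod 2), c mod 3, d mod 4)"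
          by (simp add: \<psi>_def cls_lift_eq_iff[OF assms] flip: mod_eq_dvd_iff)
        moreover have "((a mod 2, b mod 2), c mod 3, d mod 4) \<in> carrier ?K"
          unfolding car by simp
        ultimately show "Y \<in> \<psi> ` carrier ?K" by blast
      qed
    qed
  qed
  ultimately have "\<psi> \<in> iso ?K (H3 n)"
    by (simp add: iso_def)
  then show ?thesis
    using group.iso_sym[OF grp] by (auto simp: is_iso_def)
qed

theorem theorem1p3:
  fixes n :: nat
  assumes "n \<ge> 6"
  shows "let G = sym_group n;
             P = (P_basis n :: nat \<Rightarrow> 'x cell set);
             dP = (\<lambda>_ :: nat. P_bd n);
             H = trunc_homology G P dP 3;
             cls = trunc_class G P dP 3;
             x1 = cls (gen G (G31 1));
             x2 = cls (gen G (G33 1 3 5));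
             x3 = cls (gen G (G36 1));
             x4 = cls (gen G (G37 1) + gen G (G32 1 3))
         in
           H \<cong> (integer_mod_group 2 \<times>\<times> integer_mod_group 2) \<times>\<times>
               integer_mod_group 3 \<times>\<times> integer_mod_group 4 \<and>
           carrier H = generate H {x1, x2, x3, x4} \<and>
           group.ord H x1 = 2 \<and> group.ord H x2 = 2 \<and>
           group.ord H x3 = 3 \<and> group.ord H x4 = 4 \<and>
           (\<forall>S d \<epsilon>. completes_P n S d \<epsilon> \<longrightarrow>
              group_homology G S d 3 = H \<and>
              (\<forall>x\<in>carrier (free_mod G (P 3)). homology_class G S d 3 x = cls x))"
proof -
  have lift: "E (G31 1) = lift 1 0 0 0" "E (G33 1 3 5) = lift 0 1 0 0" "E (G36 1) = lift 0 0 1 0"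
    "E (G37 1) + E (G32 1 3) = lift 0 0 0 1"
    by (simp_all add: lift_def)
  have ord: "group.ord (H3 n) (cls n (lift 1 0 0 0)) = 2" "group.ord (H3 n) (cls n (lift 0 1 0 0)) = 2"
    "group.ord (H3 n) (cls n (lift 0 0 1 0)) = 3" "group.ord (H3 n) (cls n (lift 0 0 0 1)) = 4"
    by (rule ord_cls_lift[OF assms], simp)+
  show ?thesis
    unfolding Let_def trunc_homology_3 trunc_class_3 gen_sym_group lift
    by (intro conjI allI impI ballI H3_iso[OF assms] generate_H3[OF assms] ord completion)
qed

end
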